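(* Let $X$ be a real normed space of finite dimension $d$, let $S$ be a non-empty set and let $p\in X^S$ be a placement of $S$ in $X$. Then $d\le\dim\mathcal{T}(p)\le\dim\operatorname{Isom}(X)$, and $\dim\mathcal{T}(p)=\dim\operatorname{Isom}(X)$ if and only if $p$ is full.
   Context: $\operatorname{Isom}(X)$ is the group of isometries of $X$; every isometry of $X$ is affine, $\operatorname{Isom}(X)$ has the topology inherited from the finite dimensional space $A(X)$ of affine maps $X\to X$, and it is a Lie group. A placement of a set $S$ in $X$ is $p=(p_v)_{v\in S}\in X^S$, where $X^S$ has the product topology. For $g\in A(X)$, $x\in X^S$ put $g.x:=(g(x_v))_{v\in S}$. The orbit is $\mathcal{O}_p=\{g.p:g\in\operatorname{Isom}(X)\}$ and $\phi_p:\operatorname{Isom}(X)\to\mathcal{O}_p$, $g\mapsto g.p$. The orbit $\mathcal{O}_p$ is a smooth submanifold of the finite dimensional linear space $\{h.p:h\in A(X)\}\subseteq X^S$ and is given this smooth structure. A trivial finite motion of $p$ is a family $\alpha=(\alpha_v)_{v\in S}$ of continuous paths $\alpha_v:(-\delta,\delta)\to X$ (for some fixed $\delta>0$) with $\alpha_v(0)=p_v$ for all $v$ and $(\alpha_v(t))_{v\in S}\in\mathcal{O}_p$ for all $t\in(-\delta,\delta)$. $\mathcal{T}(p)$ is the set of trivial (infinitesimal) motions of $p$: those $u\in X^S$ for which there is a trivial finite motion $\alpha$ of $p$, differentiable at $t=0$, with $u_v=\alpha_v'(0)$ for all $v\in S$; it is a linear space. $p$ is full if $\phi_p$ is a smooth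 local diffeomorphism, i.e. $d\phi_p(g)$ is bijective for all $g\in\operatorname{Isom}(X)$. *)

theory Defs
  imports "HOL-Analysis.Analysis" "HOL-Library.Function_Algebras"
begin

instantiation "fun" :: (type, scaleR) scaleR
begin

definition scaleR_fun :: "real \<Rightarrow> ('a \<Rightarrow> 'b) \<Rightarrow> 'a \<Rightarrow> 'b"
  where "scaleR_fun c f = (\<lambda>x. c *\<^sub>R f x)"

instance ..

end

instance "fun" :: (type, real_vector) real_vector
  by standard (simp_all add: scaleR_fun_def plus_fun_def scaleR_add_right scaleR_add_left)

text \<open>The library \<^const>\<open>dim\<close> is 0 on sets that span an infinite-dimensional space, so
  finite-dimensionality has to be stated separately.\<close>

definition finite_dimensional :: "'a::real_vector set \<Rightarrow> bool"
  where "finite_dimensional V \<longleftrightarrow> (\<exists>B. finite B \<and> V \<subseteq> span B)"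

text \<open>Placements of \<open>S\<close> in \<open>X\<close> are functions \<open>'s \<Rightarrow> 'a\<close>, which carry the product topology.
  Affine maps of \<open>X\<close> are elements of \<open>'a \<Rightarrow> 'a\<close>. When \<open>X\<close> is finite-dimensional,
  the product topology of \<open>'a \<Rightarrow> 'a\<close> induces on the affine maps the usual topology of a
  finite-dimensional real vector space, and hence the usual topology on the isometries.
  For \<open>g :: 'a \<Rightarrow> 'a\<close> and a placement \<open>p\<close>, the placement \<open>g.p\<close> is \<open>g \<circ> p\<close>.\<close>

definition isometries :: "('a::metric_space \<Rightarrow> 'a) set"
  where "isometries = {g. surj g \<and> (\<forall>x y. dist (g x) (g y) = dist x y)}"

definition orbit_map :: "('s \<Rightarrow> 'a) \<Rightarrow> ('a \<Rightarrow> 'a) \<Rightarrow> 's \<Rightarrow> 'a"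
  where "orbit_map p g = g \<circ> p"

definition placement_orbit :: "('s \<Rightarrow> 'a::metric_space) \<Rightarrow> ('s \<Rightarrow> 'a) set"
  where "placement_orbit p = orbit_map p ` isometries"

definition trivial_finite_motion ::
    "('s \<Rightarrow> 'a::metric_space) \<Rightarrow> real \<Rightarrow> ('s \<Rightarrow> real \<Rightarrow> 'a) \<Rightarrow> bool"
  where "trivial_finite_motion p \<delta> \<alpha> \<longleftrightarrow>
    0 < \<delta> \<and> (\<forall>v. continuous_on {-\<delta><..<\<delta>} (\<alpha> v)) \<and> (\<forall>v. \<alpha> v 0 = p v) \<and>
    (\<forall>t\<in>{-\<delta><..<\<delta>}. (\<lambda>v. \<alpha> v t) \<in> placement_orbit p)"

definition trivial_motions :: "('s \<Rightarrow> 'a::real_normed_vector) \<Rightarrow> ('s \<Rightarrow> 'a) set"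
  where "trivial_motions p =
    {u. \<exists>\<delta> \<alpha>. trivial_finite_motion p \<delta> \<alpha> \<and> (\<forall>v. (\<alpha> v has_vector_derivative u v) (at 0))}"

definition locally_Euclidean :: "nat \<Rightarrow> 'a topology \<Rightarrow> bool"
  where "locally_Euclidean n T \<longleftrightarrow>
    (\<forall>x\<in>topspace T. \<exists>U W. openin T U \<and> x \<in> U \<and> openin (Euclidean_space n) W \<and>
       subtopology T U homeomorphic_space subtopology (Euclidean_space n) W)"

definition manifold_dim :: "'a topology \<Rightarrow> nat"
  where "manifold_dim T = (THE n. locally_Euclidean n T)"

text \<open>Submanifolds of finite-dimensional subspaces of \<open>'i \<Rightarrow> 'a\<close>: the isometries are one
  (with \<open>'i = 'a\<close>, inside the space of affine maps), and so is the orbit of a placement (inside the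
  space of its affine images). Since the curves below stay in such a subspace, they are smooth
  exactly if all their coordinates are, and derivatives can be taken coordinatewise.
  \<open>D n\<close> is the \<open>n\<close>-th derivative of the curve.\<close>

definition has_velocity :: "(real \<Rightarrow> 'i \<Rightarrow> 'a::real_normed_vector) \<Rightarrow> ('i \<Rightarrow> 'a) \<Rightarrow> real \<Rightarrow> bool"
  where "has_velocity \<gamma> u t \<longleftrightarrow> (\<forall>i. ((\<lambda>s. \<gamma> s i) has_vector_derivative u i) (at t))"

definition smooth_curve :: "real \<Rightarrow> (real \<Rightarrow> 'i \<Rightarrow> 'a::real_normed_vector) \<Rightarrow> bool"
  where "smooth_curve \<delta> \<gamma> \<longleftrightarrow>
    (\<exists>D :: nat \<Rightarrow> real \<Rightarrow> 'i \<Rightarrow> 'a. D 0 = \<gamma> \<and>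
       (\<forall>n. \<forall>t\<in>{-\<delta><..<\<delta>}. has_velocity (D n) (D (Suc n) t) t))"

definition smooth_curve_through ::
    "('i \<Rightarrow> 'a::real_normed_vector) set \<Rightarrow> ('i \<Rightarrow> 'a) \<Rightarrow> ('i \<Rightarrow> 'a) \<Rightarrow> (real \<Rightarrow> 'i \<Rightarrow> 'a) \<Rightarrow> bool"
  where "smooth_curve_through M x u \<gamma> \<longleftrightarrow>
    (\<exists>\<delta>>0. smooth_curve \<delta> \<gamma> \<and> \<gamma> ` {-\<delta><..<\<delta>} \<subseteq> M) \<and> \<gamma> 0 = x \<and> has_velocity \<gamma> u 0"

definition tangent_space ::
    "('i \<Rightarrow> 'a::real_normed_vector) set \<Rightarrow> ('i \<Rightarrow> 'a) \<Rightarrow> ('i \<Rightarrow> 'a) set"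
  where "tangent_space M x = {u. \<exists>\<gamma>. smooth_curve_through M x u \<gamma>}"

definition differential ::
    "('i \<Rightarrow> 'a::real_normed_vector) set \<Rightarrow> (('i \<Rightarrow> 'a) \<Rightarrow> 'j \<Rightarrow> 'b::real_normed_vector) \<Rightarrow>
     ('i \<Rightarrow> 'a) \<Rightarrow> ('i \<Rightarrow> 'a) \<Rightarrow> 'j \<Rightarrow> 'b"
  where "differential M f x u =
    (THE w. \<exists>\<gamma>. smooth_curve_through M x u \<gamma> \<and> has_velocity (f \<circ> \<gamma>) w 0)"

definition full :: "('s \<Rightarrow> 'a::real_normed_vector) \<Rightarrow> bool"
  where "full p \<longleftrightarrow>
    (\<forall>g\<in>isometries. bij_betw (differential isometries (orbit_map p) g)
       (tangent_space isometries g) (tangent_space (placement_orbit p) (orbit_map p g)))"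

end

theory Submission
  imports Defs "HOL-Homology.Invariance_of_Domain"
begin

text \<open>
  Why the theorem holds. Let \<open>G\<close> be the isometry group of \<open>X\<close> and \<open>L\<close> its Lie algebra. The
  differential at the identity of the orbit map of \<open>p\<close> sends \<open>A \<in> L\<close> to the restriction of the
  Killing field of \<open>A\<close> to the points of \<open>p\<close>; call it the motion of \<open>p\<close> generated by \<open>A\<close>. If every
  trivial motion arises in this way, then the space of trivial motions is a linear image of \<open>L\<close>, so
  its dimension is at most \<open>dim L = dim G\<close>, with equality exactly if the linear map is injective.
  The map of tangent spaces at \<open>g \<in> G\<close> is always onto; it is injective at every \<open>g\<close> as soon as it
  is injective at the identity, because conjugation by \<open>g\<close> carries the kernel at the identity onto
  the kernel at \<open>g\<close>. Hence equality means fullness. The lower bound \<open>d\<close> comes from the translations.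

  Three facts carry this outline.

  \<^item> \<^emph>\<open>\<open>G\<close> is a closed group in a Banach algebra.\<close> By the Mazur--Ulam theorem isometries are affine
    (\<open>isometry_affine\<close>), so \<open>G\<close> acts by composition on the affine functions \<open>X \<rightarrow> \<real>\<close>. The
    operators on the space of affine functions form a finite-dimensional Banach algebra, in which
    the exponential series converges, and \<open>G\<close> is homeomorphic to a closed subgroup of it
    (\<open>homeomorphism_isometries\<close>). Affine functions are used since the dual of any normed space is
    complete, whereas completeness of \<open>X\<close> is a consequence of its finite dimension that its type
    does not record.

  \<^item> \<^emph>\<open>A closed group has a Lie algebra.\<close> The set \<open>L\<close> of all \<open>A\<close> with \<open>exp (t A) \<in> G\<close> for all \<open>t\<close>
    contains every limit of directions \<open>(g n - 1) / e n\<close> with \<open>g n \<in> G\<close> and \<open>e n \<rightarrow> 0\<close>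
    (\<open>limit_direction_in_lie_algebra\<close>). It is therefore a subspace, and \<open>exp\<close> maps small elements
    of \<open>L\<close> onto a neighbourhood of \<open>1\<close> in \<open>G\<close> (\<open>exp_covers_neighbourhood\<close>). Thus \<open>G\<close> is locally
    homeomorphic to \<open>L\<close>, and invariance of domain makes \<open>dim L\<close> the only possible value of the
    dimension of \<open>G\<close> (\<open>manifold_dim_isometries\<close>).

  \<^item> \<^emph>\<open>Every trivial motion is generated by the Lie algebra.\<close> A trivial finite motion is
    \<open>\<alpha> t = g t \<circ> p\<close> with isometries \<open>g t\<close> that need not depend continuously on \<open>t\<close>. Among all
    isometries with the same effect on \<open>p\<close>, the ones nearest to the identity do tend to the
    identity, at the speed of \<open>\<alpha>\<close>; a limit of their directions is the required element of \<open>L\<close>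
    (\<open>orbit_velocity_in_lie_algebra\<close>, \<open>trivial_motion_imp_motion\<close>).

  The same argument identifies all the tangent spaces in the definition of fullness, because a smooth
  curve in an orbit is a trivial finite motion.
\<close>

section \<open>Finite-dimensional normed spaces\<close>

lemma obtain_finite_basis:
  assumes "finite_dimensional (UNIV :: 'a::real_vector set)"
  obtains B :: "'a::real_vector set" where "finite B" "independent B" "span B = UNIV" "card B = dim (UNIV :: 'a::real_vector set)"
proof -
  obtain B :: "'a set" where B: "B \<subseteq> UNIV" "independent B" "UNIV \<subseteq> span B" "card B = dim (UNIV :: 'a set)"
    using basis_exists by blast
  obtain C :: "'a set" where C: "finite C" "UNIV \<subseteq> span C"
    using assms unfolding finite_dimensional_def by blast
  have "finite B"
    using independent_span_bound[OF C(1) B(2)] C(2) by auto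
  with B that show ?thesis by blast
qed

lemma compact_Pi_UNIV:
  assumes "\<And>i. compact (S i)"
  shows "compact {a :: 'i \<Rightarrow> 'b::topological_space. \<forall>i. a i \<in> S i}"
proof -
  have "compactin (product_topology (\<lambda>i::'i. euclidean :: 'b topology) UNIV) (PiE UNIV S)"
    unfolding compactin_PiE using assms by simp
  moreover have "PiE UNIV S = {a. \<forall>i. a i \<in> S i}"
    by (auto simp: PiE_def Pi_def)
  ultimately show ?thesis
    by (simp add: euclidean_product_topology)
qed

lemma continuous_on_coordinate [continuous_intros]:
  "continuous_on A (\<lambda>a :: 'i \<Rightarrow> 'b::topological_space. a i)"
  by (rule continuous_on_subset[OF continuous_on_product_coordinates]) simp

text \<open>All norms on a finite-dimensional space are equivalent. The constant is the reciprocal of the minimum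
  of the norm over the unit sphere of the coefficient space, which is compact as a closed subset of a
  product of intervals.\<close>

lemma coefficient_bound:
  fixes B :: "'e::real_normed_vector set"
  assumes "finite B" "independent B"
  obtains c where "c > 0" "\<And>a. (\<Sum>b\<in>B. \<bar>a b\<bar>) \<le> c * norm (\<Sum>b\<in>B. a b *\<^sub>R b)"
proof (cases "B = {}")
  case True
  with that[of 1] show ?thesis by simp
next
  case False
  define K where "K = {a :: 'e \<Rightarrow> real. \<forall>b. a b \<in> (if b \<in> B then {-1..1} else {0})}"
  define S where "S = {a \<in> K. (\<Sum>b\<in>B. \<bar>a b\<bar>) = 1}"
  have "compact K"
    unfolding K_def by (rule compact_Pi_UNIV) auto
  moreover have "closed {a :: 'e \<Rightarrow> real. (\<Sum>b\<in>B. \<bar>a b\<bar>) = 1}"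
    by (intro closed_Collect_eq continuous_intros)
  moreover have "S = K \<inter> {a. (\<Sum>b\<in>B. \<bar>a b\<bar>) = 1}"
    by (auto simp: S_def)
  ultimately have "compact S"
    by (simp add: compact_Int_closed)
  moreover have "S \<noteq> {}"
  proof -
    obtain b0 where "b0 \<in> B" using False by blast
    then have "(\<lambda>b. if b = b0 then 1 else 0) \<in> S"
      using assms(1) by (auto simp: S_def K_def if_distrib[of abs] cong: if_cong)
    then show ?thesis by blast
  qed
  moreover have "continuous_on S (\<lambda>a. norm (\<Sum>b\<in>B. a b *\<^sub>R b))"
    by (intro continuous_intros)
  ultimately have "\<exists>m\<in>S. \<forall>a\<in>S. norm (\<Sum>b\<in>B. m b *\<^sub>R b) \<le> norm (\<Sum>b\<in>B. a b *\<^sub>R b)"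
    by (rule continuous_attains_inf)
  then obtain m where m: "m \<in> S"
    "\<And>a. a \<in> S \<Longrightarrow> norm (\<Sum>b\<in>B. m b *\<^sub>R b) \<le> norm (\<Sum>b\<in>B. a b *\<^sub>R b)"
    by blast
  define k where "k = norm (\<Sum>b\<in>B. m b *\<^sub>R b)"
  have "k \<noteq> 0"
  proof
    assume "k = 0"
    then have "\<And>b. b \<in> B \<Longrightarrow> m b = 0"
      using independentD[OF assms(2,1) subset_refl, of m] unfolding k_def by simp
    with m(1) show False by (simp add: S_def)
  qed
  then have k: "k > 0" by (simp add: k_def)
  show ?thesis
  proof
    show "1 / k > 0" using k by simp
    fix a :: "'e \<Rightarrow> real"
    define s where "s = (\<Sum>b\<in>B. \<bar>a b\<bar>)"
    have s0: "s \<ge> 0" by (simp add: s_def sum_nonneg)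
    show "(\<Sum>b\<in>B. \<bar>a b\<bar>) \<le> 1 / k * norm (\<Sum>b\<in>B. a b *\<^sub>R b)"
    proof (cases "s = 0")
      case True
      then show ?thesis using k by (simp add: s_def)
    next
      case False
      then have s: "s > 0" using s0 by simp
      define a' where "a' = (\<lambda>b. if b \<in> B then a b / s else 0)"
      have sum1: "(\<Sum>b\<in>B. \<bar>a' b\<bar>) = 1"
        using s by (simp add: a'_def abs_divide flip: sum_divide_distrib s_def)
      have "\<bar>a' b\<bar> \<le> 1" if "b \<in> B" for b
        using member_le_sum[OF that, of "\<lambda>b. \<bar>a' b\<bar>"] assms(1) sum1 by simp
      then have "a' \<in> S"
        using sum1 unfolding S_def K_def by (fastforce simp: a'_def abs_le_iff)
      then have "k \<le> norm (\<Sum>b\<in>B. a' b *\<^sub>R b)"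
        using m(2) k_def by simp
      also have "(\<Sum>b\<in>B. a' b *\<^sub>R b) = (1 / s) *\<^sub>R (\<Sum>b\<in>B. a b *\<^sub>R b)"
        by (simp add: a'_def scaleR_sum_right)
      also have "norm \<dots> = norm (\<Sum>b\<in>B. a b *\<^sub>R b) / s"
        using s by simp
      finally show ?thesis
        using k s by (simp add: field_simps flip: s_def)
    qed
  qed
qed

lemma representation_bound:
  fixes B :: "'e::real_normed_vector set"
  assumes "finite B" "independent B"
  obtains c where "c > 0" "\<And>x. x \<in> span B \<Longrightarrow> (\<Sum>b\<in>B. \<bar>representation B x b\<bar>) \<le> c * norm x"
proof -
  obtain c where c: "c > 0" "\<And>a. (\<Sum>b\<in>B. \<bar>a b\<bar>) \<le> c * norm (\<Sum>b\<in>B. a b *\<^sub>R b)"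
    using coefficient_bound[OF assms] by blast
  show ?thesis
  proof
    fix x assume "x \<in> span B"
    then show "(\<Sum>b\<in>B. \<bar>representation B x b\<bar>) \<le> c * norm x"
      using c(2)[of "representation B x"]
        sum_representation_eq[OF assms(2) _ assms(1) subset_refl, of x] by simp
  qed (rule c(1))
qed

lemma bounded_linear_coordinate:
  fixes B :: "'e::real_normed_vector set"
  assumes "finite B" "independent B" "span B = UNIV"
  shows "bounded_linear (\<lambda>x. representation B x b)"
proof (cases "b \<in> B")
  case True
  obtain c where c: "c > 0" "\<And>x. x \<in> span B \<Longrightarrow> (\<Sum>b\<in>B. \<bar>representation B x b\<bar>) \<le> c * norm x"
    using representation_bound[OF assms(1,2)] by blast
  show ?thesis
  proof (rule bounded_linear_intro)
    fix x y :: 'e and r :: real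
    show "representation B (x + y) b = representation B x b + representation B y b"
      by (simp add: representation_add assms)
    show "representation B (r *\<^sub>R x) b = r *\<^sub>R representation B x b"
      by (simp add: representation_scale assms)
    show "norm (representation B x b) \<le> norm x * c"
      using member_le_sum[OF True, of "\<lambda>b. \<bar>representation B x b\<bar>"] c(2)[of x] assms
      by (simp add: mult.commute)
  qed
next
  case False
  then have "representation B x b = 0" for x
    using representation_ne_zero[of B x b] by blast
  then show ?thesis by simp
qed

lemma sum_coordinates:
  fixes B :: "'e::real_vector set"
  assumes "finite B" "independent B" "span B = UNIV"
  shows "(\<Sum>b\<in>B. representation B x b *\<^sub>R b) = x"
  by (rule sum_representation_eq[OF assms(2) _ assms(1) subset_refl]) (simp add: assms(3))

lemma linear_imp_bounded_linear:
  fixes f :: "'e::real_normed_vector \<Rightarrow> 'f::real_normed_vector"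
  assumes "finite_dimensional (UNIV :: 'e::real_normed_vector set)" "linear f"
  shows "bounded_linear f"
proof -
  obtain B :: "'e set" where B: "finite B" "independent B" "span B = UNIV"
    by (rule obtain_finite_basis[OF assms(1)])
  have "f x = (\<Sum>b\<in>B. representation B x b *\<^sub>R f b)" for x
  proof -
    have "f (\<Sum>b\<in>B. representation B x b *\<^sub>R b) = (\<Sum>b\<in>B. representation B x b *\<^sub>R f b)"
      by (simp add: linear_sum[OF assms(2)] linear_scale[OF assms(2)])
    then show ?thesis by (simp add: sum_coordinates[OF B])
  qed
  then have "f = (\<lambda>x. \<Sum>b\<in>B. representation B x b *\<^sub>R f b)" by blast
  moreover have "bounded_linear (\<lambda>x. \<Sum>b\<in>B. representation B x b *\<^sub>R f b)"
    by (intro bounded_linear_sum bounded_linear_scaleR_const bounded_linear_coordinate B)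
  ultimately show ?thesis by simp
qed

lemma compact_cball_finite_dimensional:
  assumes "finite_dimensional (UNIV :: 'e::real_normed_vector set)"
  shows "compact (cball (0::'e::real_normed_vector) r)"
proof -
  obtain B :: "'e set" where B: "finite B" "independent B" "span B = UNIV"
    by (rule obtain_finite_basis[OF assms(1)])
  obtain c where c: "c > 0" "\<And>x. x \<in> span B \<Longrightarrow> (\<Sum>b\<in>B. \<bar>representation B x b\<bar>) \<le> c * norm x"
    using representation_bound[OF B(1,2)] by blast
  define K where "K = {a :: 'e \<Rightarrow> real. \<forall>b. a b \<in> {-(c*r)..c*r}}"
  define f where "f a = (\<Sum>b\<in>B. a b *\<^sub>R b)" for a :: "'e \<Rightarrow> real"
  have "compact K"
    unfolding K_def by (rule compact_Pi_UNIV) auto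
  moreover have "continuous_on K f"
    unfolding f_def by (intro continuous_intros)
  ultimately have "compact (f ` K)"
    using compact_continuous_image by blast
  moreover have "cball 0 r \<subseteq> f ` K"
  proof
    fix x :: 'e assume "x \<in> cball 0 r"
    then have r: "norm x \<le> r" by simp
    then have cr: "c * norm x \<le> c * r" using c by simp
    have "\<bar>representation B x b\<bar> \<le> c * r" for b
    proof (cases "b \<in> B")
      case True
      then show ?thesis
        using member_le_sum[OF True, of "\<lambda>b. \<bar>representation B x b\<bar>"] c(2)[of x] B cr by simp
    next
      case False
      then have "representation B x b = 0" using representation_ne_zero[of B x b] by blast
      moreover have "0 \<le> c * norm x" using c by simp
      ultimately show ?thesis using cr by linarith
    qed
    then have "- (c * r) \<le> representation B x b \<and> representation B x b \<le> c * r" for b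
      using abs_le_iff minus_le_iff by blast
    then have "representation B x \<in> K"
      unfolding K_def by simp
    moreover have "x = f (representation B x)"
      by (simp add: f_def sum_coordinates[OF B])
    ultimately show "x \<in> f ` K" by blast
  qed
  ultimately show ?thesis
    using compact_Int_closed[OF _ closed_cball, of "f ` K" 0 r] by (simp add: Int_absorb1)
qed

lemma finite_dimensional_prod:
  assumes "finite_dimensional (UNIV :: 'a::real_vector set)"
    and "finite_dimensional (UNIV :: 'b::real_vector set)"
  shows "finite_dimensional (UNIV :: ('a::real_vector \<times> 'b::real_vector) set)"
proof -
  obtain A :: "'a set" where A: "finite A" "span A = UNIV"
    by (rule obtain_finite_basis[OF assms(1)])
  obtain B :: "'b set" where B: "finite B" "span B = UNIV"
    by (rule obtain_finite_basis[OF assms(2)])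
  have la: "linear (\<lambda>x::'a. (x, 0::'b))" and lb: "linear (\<lambda>y::'b. (0::'a, y))"
    by (auto intro!: linearI)
  let ?C = "(\<lambda>x. (x, 0)) ` A \<union> (\<lambda>y. (0, y)) ` B :: ('a \<times> 'b) set"
  have "(x, y) \<in> span ?C" for x y
  proof -
    have "(x, 0) \<in> span ((\<lambda>x. (x, 0::'b)) ` A)"
      unfolding linear_span_image[OF la] A by blast
    moreover have "(0, y) \<in> span ((\<lambda>y. (0::'a, y)) ` B)"
      unfolding linear_span_image[OF lb] B by blast
    ultimately have "(x, 0) + (0, y) \<in> span ?C"
      by (meson span_add span_mono subset_iff sup_ge1 sup_ge2)
    then show ?thesis by simp
  qed
  then have "UNIV \<subseteq> span ?C" by auto
  with A B show ?thesis unfolding finite_dimensional_def by blast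
qed

text \<open>The rank-one maps \<open>x \<mapsto> x\<^sub>a b\<close>, for a coordinate \<open>x\<^sub>a\<close> and a basis vector \<open>b\<close>, span.\<close>

lemma finite_dimensional_blinfun:
  assumes "finite_dimensional (UNIV :: 'a::real_normed_vector set)"
    and "finite_dimensional (UNIV :: 'b::real_normed_vector set)"
  shows "finite_dimensional (UNIV :: ('a::real_normed_vector \<Rightarrow>\<^sub>L 'b::real_normed_vector) set)"
proof -
  obtain A :: "'a set" where A: "finite A" "independent A" "span A = UNIV"
    by (rule obtain_finite_basis[OF assms(1)])
  obtain B :: "'b set" where B: "finite B" "independent B" "span B = UNIV"
    by (rule obtain_finite_basis[OF assms(2)])
  define T where "T a b = Blinfun (\<lambda>x. representation A x a *\<^sub>R b)" for a and b :: 'b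
  have T: "blinfun_apply (T a b) x = representation A x a *\<^sub>R b" for a b x
    unfolding T_def
    by (subst bounded_linear_Blinfun_apply)
      (auto intro!: bounded_linear_scaleR_const bounded_linear_coordinate A)
  have "F = (\<Sum>a\<in>A. \<Sum>b\<in>B. representation B (blinfun_apply F a) b *\<^sub>R T a b)" for F
  proof (rule blinfun_eqI)
    fix x
    have "blinfun_apply (\<Sum>a\<in>A. \<Sum>b\<in>B. representation B (blinfun_apply F a) b *\<^sub>R T a b) x
      = (\<Sum>a\<in>A. representation A x a *\<^sub>R (\<Sum>b\<in>B. representation B (blinfun_apply F a) b *\<^sub>R b))"
      by (simp add: blinfun.sum_left blinfun.scaleR_left T scaleR_sum_right mult.commute)
    also have "\<dots> = (\<Sum>a\<in>A. representation A x a *\<^sub>R blinfun_apply F a)"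
      by (simp add: sum_coordinates[OF B])
    also have "\<dots> = blinfun_apply F (\<Sum>a\<in>A. representation A x a *\<^sub>R a)"
      by (simp add: blinfun.sum_right blinfun.scaleR_right)
    finally show "blinfun_apply F x = blinfun_apply
      (\<Sum>a\<in>A. \<Sum>b\<in>B. representation B (blinfun_apply F a) b *\<^sub>R T a b) x"
      by (simp add: sum_coordinates[OF A])
  qed
  moreover have "(\<Sum>a\<in>A. \<Sum>b\<in>B. representation B (blinfun_apply F a) b *\<^sub>R T a b)
      \<in> span ((\<lambda>(a, b). T a b) ` (A \<times> B))" for F
    by (intro span_sum span_scale span_base) auto
  ultimately have "UNIV \<subseteq> span ((\<lambda>(a, b). T a b) ` (A \<times> B))" by (metis subsetI)
  with A B show ?thesis
    unfolding finite_dimensional_def by (meson finite_SigmaI finite_imageI)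
qed

lemma finite_dimensional_real: "finite_dimensional (UNIV :: real set)"
  unfolding finite_dimensional_def by (rule exI[of _ "{1}"]) (auto simp: span_singleton)

section \<open>Closed subgroups of Banach algebras\<close>

lemma exp_scaleR_of_nat:
  fixes A :: "'e::{real_normed_algebra_1,banach}"
  shows "exp (real k *\<^sub>R A) = exp A ^ k"
proof (induction k)
  case (Suc k)
  have "exp (real (Suc k) *\<^sub>R A) = exp (A + real k *\<^sub>R A)"
    by (simp add: algebra_simps)
  also have "\<dots> = exp A * exp (real k *\<^sub>R A)"
    by (rule exp_add_commuting) simp
  finally show ?case using Suc by simp
qed simp

lemma exp_mult_exp_minus:
  fixes A :: "'e::{real_normed_algebra_1,banach}"
  shows "exp A * exp (- A) = 1" "exp (- A) * exp A = 1"
  using exp_add_commuting[of A "- A"] exp_add_commuting[of "- A" A] by simp_all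

lemma norm_power_diff_le:
  fixes z w :: "'e::real_normed_algebra_1"
  assumes "norm z \<le> c" "norm w \<le> c"
  shows "norm (z ^ Suc k - w ^ Suc k) \<le> real (Suc k) * c ^ k * norm (z - w)"
proof (induction k)
  case (Suc k)
  have c: "0 \<le> c" using assms norm_ge_zero order_trans by blast
  have "z ^ Suc (Suc k) - w ^ Suc (Suc k) = z * (z ^ Suc k - w ^ Suc k) + (z - w) * w ^ Suc k"
    by (simp add: algebra_simps)
  then have "norm (z ^ Suc (Suc k) - w ^ Suc (Suc k))
      \<le> norm z * norm (z ^ Suc k - w ^ Suc k) + norm (z - w) * norm (w ^ Suc k)"
    by (metis add_mono norm_mult_ineq norm_triangle_le)
  also have "\<dots> \<le> c * (real (Suc k) * c ^ k * norm (z - w)) + norm (z - w) * c ^ Suc k"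
  proof (intro add_mono mult_mono Suc.IH assms)
    show "norm (w ^ Suc k) \<le> c ^ Suc k"
      using norm_power_ineq[of w "Suc k"] power_mono[OF assms(2) norm_ge_zero, of "Suc k"] by linarith
  qed (use c in auto)
  also have "\<dots> = real (Suc (Suc k)) * c ^ Suc k * norm (z - w)"
    by (simp add: algebra_simps)
  finally show ?case .
qed simp

text \<open>The exponential is strictly differentiable at \<open>0\<close> with derivative the identity: after cancelling
  the terms of order at most \<open>1\<close>, the series for \<open>exp A - exp B\<close> is dominated by that of
  \<open>(exp r - 1) * norm (A - B)\<close>. This gives both the continuity of \<open>exp\<close> and its injectivity near
  \<open>0\<close>.\<close>

lemma exp_strict_derivative_bound:
  fixes A B :: "'e::{real_normed_algebra_1,banach}"
  assumes "norm A \<le> r" "norm B \<le> r"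
  shows "norm (exp A - exp B - (A - B)) \<le> (exp r - 1) * norm (A - B)"
proof -
  define f where "f k = (A ^ k - B ^ k) /\<^sub>R fact k" for k :: nat
  have "f sums (exp A - exp B)"
    unfolding f_def scaleR_diff_right by (intro sums_diff exp_converges)
  then have "(\<lambda>k. f (k + 2)) sums (exp A - exp B - (\<Sum>k<2. f k))"
    by (rule sums_split_initial_segment)
  moreover have "(\<Sum>k<2. f k) = A - B"
    by (simp add: f_def eval_nat_numeral)
  ultimately have s1: "(\<lambda>k. f (k + 2)) sums (exp A - exp B - (A - B))" by simp
  have "(\<lambda>k. r ^ k /\<^sub>R fact k) sums exp r" by (rule exp_converges)
  then have "(\<lambda>k. r ^ (k + 1) /\<^sub>R fact (k + 1)) sums (exp r - (\<Sum>k<1. r ^ k /\<^sub>R fact k))"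
    by (rule sums_split_initial_segment)
  then have s2: "(\<lambda>k. (r ^ (k + 1) /\<^sub>R fact (k + 1)) * norm (A - B)) sums ((exp r - 1) * norm (A - B))"
    by (intro sums_mult2) simp
  have "norm (f (k + 2)) \<le> (r ^ (k + 1) /\<^sub>R fact (k + 1)) * norm (A - B)" for k
  proof -
    have "norm (f (k + 2)) = norm (A ^ Suc (Suc k) - B ^ Suc (Suc k)) / fact (k + 2)"
      by (simp add: f_def divide_inverse_commute del: fact_Suc power_Suc)
    also have "\<dots> \<le> (real (Suc (Suc k)) * r ^ Suc k * norm (A - B)) / fact (k + 2)"
      by (intro divide_right_mono norm_power_diff_le assms) simp
    also have "\<dots> = (r ^ (k + 1) /\<^sub>R fact (k + 1)) * norm (A - B)"
    proof -
      have "fact (k + 2) = real (Suc (Suc k)) * fact (k + 1)" by simp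
      then show ?thesis
        by (simp add: divide_inverse_commute del: fact_Suc of_nat_Suc)
    qed
    finally show ?thesis .
  qed
  with s1 s2 show ?thesis by (rule norm_sums_le)
qed

text \<open>Directions are always taken along sequences, so that compactness can be applied to them.\<close>

lemma has_vector_derivative_imp_sequence:
  assumes "(\<gamma> has_vector_derivative u) (at 0)" "e \<longlonglongrightarrow> 0" "\<And>n. e n \<noteq> 0"
  shows "(\<lambda>n. (\<gamma> (e n) - \<gamma> 0) /\<^sub>R e n) \<longlonglongrightarrow> u"
proof -
  have "((\<lambda>y. norm (\<gamma> y - \<gamma> 0 - y *\<^sub>R u) / norm y) \<longlongrightarrow> 0) (at 0)"
    using assms(1) unfolding has_vector_derivative_def has_derivative_iff_norm by simp
  moreover have "filterlim e (at 0) sequentially"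
    using assms(2,3) by (simp add: filterlim_at)
  ultimately have "(\<lambda>n. norm (\<gamma> (e n) - \<gamma> 0 - e n *\<^sub>R u) / norm (e n)) \<longlonglongrightarrow> 0"
    by (rule filterlim_compose)
  moreover have "norm (\<gamma> (e n) - \<gamma> 0 - e n *\<^sub>R u) / norm (e n) = norm ((\<gamma> (e n) - \<gamma> 0) /\<^sub>R e n - u)" for n
  proof -
    have "(\<gamma> (e n) - \<gamma> 0) /\<^sub>R e n - u = (\<gamma> (e n) - \<gamma> 0 - e n *\<^sub>R u) /\<^sub>R e n"
      using assms(3)[of n] by (simp add: scaleR_diff_right)
    then show ?thesis by (simp add: divide_inverse_commute)
  qed
  ultimately show ?thesis
    by (simp add: tendsto_norm_zero_iff LIM_zero_iff)
qed

lemma exp_has_vector_derivative_0: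
  fixes A :: "'e::{real_normed_algebra_1,banach}"
  shows "((\<lambda>t. exp (t *\<^sub>R A)) has_vector_derivative A) (at 0)"
  using exp_scaleR_has_vector_derivative_right[of A 0] by simp

locale closed_group =
  fixes G :: "'e::{real_normed_algebra_1,banach} set"
  assumes finite_dim: "finite_dimensional (UNIV :: 'e set)"
    and closed: "closed G"
    and one_mem: "1 \<in> G"
    and mult_mem: "g \<in> G \<Longrightarrow> h \<in> G \<Longrightarrow> g * h \<in> G"
    and inverse_mem: "g \<in> G \<Longrightarrow> \<exists>h\<in>G. g * h = 1 \<and> h * g = 1"
begin

lemma power_mem: "g \<in> G \<Longrightarrow> g ^ k \<in> G"
  by (induction k) (auto intro: one_mem mult_mem)

definition lie_algebra :: "'e set"
  where "lie_algebra = {A. \<forall>t::real. exp (t *\<^sub>R A) \<in> G}"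

text \<open>With \<open>k n = \<lfloor>1 / e n\<rfloor>\<close> the powers \<open>g n ^ k n\<close> stay in the group and tend to \<open>exp A\<close>: the element
  \<open>g n\<close> differs from \<open>exp (e n A)\<close> by \<open>o(e n)\<close>, and raising to the power \<open>k n\<close> multiplies this error
  by a bounded multiple of \<open>1 / e n\<close>.\<close>

lemma exp_limit_direction_mem:
  assumes g: "\<And>n. g n \<in> G" and e: "\<And>n. e n > 0" "e \<longlonglongrightarrow> 0"
    and lim: "(\<lambda>n. (g n - 1) /\<^sub>R e n) \<longlonglongrightarrow> A"
  shows "exp A \<in> G"
proof -
  define k where "k n = nat \<lfloor>1 / e n\<rfloor>" for n
  have k1: "real (k n) * e n \<le> 1" and k2: "1 - e n \<le> real (k n) * e n" for n
  proof -
    have "0 < 1 / e n" using e(1) by simp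
    then have *: "real (k n) = of_int \<lfloor>1 / e n\<rfloor>" unfolding k_def by (simp add: floor_less_iff)
    have "real (k n) \<le> 1 / e n" "1 / e n < real (k n) + 1" unfolding * by linarith+
    with e(1)[of n] show "real (k n) * e n \<le> 1" "1 - e n \<le> real (k n) * e n"
      by (simp_all add: field_simps)
  qed
  have ke: "(\<lambda>n. real (k n) * e n) \<longlonglongrightarrow> 1"
  proof (rule tendsto_sandwich[OF _ _ _ tendsto_const])
    show "(\<lambda>n. 1 - e n) \<longlonglongrightarrow> 1" using tendsto_diff[OF tendsto_const e(2), of 1] by simp
  qed (use k1 k2 in auto)
  have lim1: "(\<lambda>n. exp (e n *\<^sub>R A) ^ k n) \<longlonglongrightarrow> exp A"
  proof -
    have "isCont (\<lambda>t. exp (t *\<^sub>R A)) 1"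
      using exp_scaleR_has_vector_derivative_right has_vector_derivative_continuous by blast
    then have "(\<lambda>n. exp ((real (k n) * e n) *\<^sub>R A)) \<longlonglongrightarrow> exp (1 *\<^sub>R A)"
      using ke by (rule isCont_tendsto_compose)
    then show ?thesis by (simp flip: exp_scaleR_of_nat)
  qed
  \<comment> \<open>the error in one step, relative to \<open>e n\<close>\<close>
  define q where "q n = (g n - exp (e n *\<^sub>R A)) /\<^sub>R e n" for n
  have q0: "q \<longlonglongrightarrow> 0"
  proof -
    have "(\<lambda>n. (exp (e n *\<^sub>R A) - 1) /\<^sub>R e n) \<longlonglongrightarrow> A"
      using has_vector_derivative_imp_sequence[OF exp_has_vector_derivative_0 e(2), of A]
        e(1)[THEN less_imp_neq] by force
    from tendsto_diff[OF lim this] show ?thesis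
      by (simp add: q_def [abs_def] scaleR_diff_right)
  qed
  define C where "C = norm A + 1"
  have "eventually (\<lambda>n. norm ((g n - 1) /\<^sub>R e n) < C) sequentially"
    using tendsto_norm[OF lim] unfolding C_def by (rule order_tendstoD) simp
  then have "eventually (\<lambda>n. norm (g n ^ k n - exp (e n *\<^sub>R A) ^ k n) \<le> exp C * norm (q n)) sequentially"
  proof eventually_elim
    case (elim n)
    define c where "c = exp (C * e n)"
    have C0: "C > 0" unfolding C_def by (simp add: add_nonneg_pos)
    have c1: "c \<ge> 1" unfolding c_def using C0 e(1)[of n] by simp
    have "\<bar>inverse (e n)\<bar> * norm (g n - 1) < C"
      using elim unfolding norm_scaleR .
    then have "norm (g n - 1) \<le> C * e n"
      using e(1)[of n] by (simp add: field_simps)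
    then have "norm (g n) \<le> 1 + C * e n"
      using norm_triangle_ineq[of 1 "g n - 1"] by simp
    then have b1: "norm (g n) \<le> c"
      unfolding c_def using exp_ge_add_one_self[of "C * e n"] by linarith
    have b2: "norm (exp (e n *\<^sub>R A)) \<le> c"
    proof -
      have "norm (e n *\<^sub>R A) \<le> C * e n"
        using e(1)[of n] by (simp add: C_def algebra_simps)
      then show ?thesis
        unfolding c_def using norm_exp[of "e n *\<^sub>R A"] by (meson exp_le_cancel_iff order_trans)
    qed
    show ?case
    proof (cases "k n")
      case (Suc j)
      have "norm (g n ^ k n - exp (e n *\<^sub>R A) ^ k n) \<le> real (k n) * c ^ j * norm (g n - exp (e n *\<^sub>R A))"
        unfolding Suc by (rule norm_power_diff_le[OF b1 b2])
      also have "\<dots> \<le> real (k n) * c ^ k n * norm (g n - exp (e n *\<^sub>R A))"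
        using power_increasing[OF _ c1, of j "k n"] Suc by (intro mult_right_mono mult_left_mono) auto
      also have "\<dots> = (real (k n) * e n) * (c ^ k n * norm (q n))"
        using e(1)[of n] by (simp add: q_def)
      also have "\<dots> \<le> 1 * (c ^ k n * norm (q n))"
        using k1[of n] c1 by (intro mult_right_mono) auto
      also have "\<dots> \<le> exp C * norm (q n)"
      proof -
        have "c ^ k n = exp ((real (k n) * e n) * C)"
          unfolding c_def by (simp add: mult_ac flip: exp_of_nat_mult)
        also have "\<dots> \<le> exp C"
          using k1[of n] C0 by simp
        finally show ?thesis by (simp add: mult_right_mono)
      qed
      finally show ?thesis .
    qed simp
  qed
  moreover have "(\<lambda>n. exp C * norm (q n)) \<longlonglongrightarrow> 0"
    using tendsto_mult_right_zero[OF tendsto_norm_zero[OF q0]] by simp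
  ultimately have "(\<lambda>n. g n ^ k n - exp (e n *\<^sub>R A) ^ k n) \<longlonglongrightarrow> 0"
    by (rule Lim_null_comparison)
  from tendsto_add[OF this lim1] have "(\<lambda>n. g n ^ k n) \<longlonglongrightarrow> exp A" by simp
  then show ?thesis
    using closed_sequentially[OF closed, of "\<lambda>n. g n ^ k n"] power_mem[OF g] by blast
qed

text \<open>Rescaling \<open>e\<close> by \<open>1 / t\<close> turns membership of \<open>exp A\<close> into membership of \<open>exp (t A)\<close> for \<open>t > 0\<close>;
  inverses give the negative \<open>t\<close>.\<close>

lemma limit_direction_in_lie_algebra:
  assumes g: "\<And>n. g n \<in> G" and e: "\<And>n. e n > 0" "e \<longlonglongrightarrow> 0"
    and lim: "(\<lambda>n. (g n - 1) /\<^sub>R e n) \<longlonglongrightarrow> A"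
  shows "A \<in> lie_algebra"
proof -
  have pos: "exp (t *\<^sub>R A) \<in> G" if "t > 0" for t
  proof (rule exp_limit_direction_mem[OF g])
    show "e n / t > 0" for n using e(1) that by simp
    show "(\<lambda>n. e n / t) \<longlonglongrightarrow> 0" using tendsto_divide_zero[OF e(2)] .
    have "(\<lambda>n. t *\<^sub>R ((g n - 1) /\<^sub>R e n)) \<longlonglongrightarrow> t *\<^sub>R A"
      by (intro tendsto_intros lim)
    then show "(\<lambda>n. (g n - 1) /\<^sub>R (e n / t)) \<longlonglongrightarrow> t *\<^sub>R A"
      by (simp add: divide_inverse_commute)
  qed
  have "exp (t *\<^sub>R A) \<in> G" for t
  proof (cases t "0::real" rule: linorder_cases)
    case less
    then have "exp (- (t *\<^sub>R A)) \<in> G" using pos[of "- t"] by simp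
    then obtain h where "h \<in> G" "exp (- (t *\<^sub>R A)) * h = 1"
      using inverse_mem by blast
    then show ?thesis
      by (metis exp_mult_exp_minus(1) mult.assoc mult.left_neutral mult.right_neutral)
  qed (use pos one_mem in auto)
  then show ?thesis by (simp add: lie_algebra_def)
qed

lemma velocity_in_lie_algebra:
  assumes "(\<gamma> has_vector_derivative A) (at 0)" "\<gamma> 0 = 1" "\<And>t. \<gamma> t \<in> G"
  shows "A \<in> lie_algebra"
proof (rule limit_direction_in_lie_algebra)
  show "(\<lambda>n. 1 / real (Suc n)) \<longlonglongrightarrow> 0" by (rule LIMSEQ_Suc[OF lim_1_over_n])
  from has_vector_derivative_imp_sequence[OF assms(1) this]
  show "(\<lambda>n. (\<gamma> (1 / real (Suc n)) - 1) /\<^sub>R (1 / real (Suc n))) \<longlonglongrightarrow> A"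
    by (simp add: assms(2))
qed (use assms in auto)

lemma subspace_lie_algebra: "subspace lie_algebra"
proof (rule subspaceI)
  show "0 \<in> lie_algebra" by (simp add: lie_algebra_def one_mem)
  show "c *\<^sub>R A \<in> lie_algebra" if "A \<in> lie_algebra" for c A
    using that by (simp add: lie_algebra_def)
  fix A B assume AB: "A \<in> lie_algebra" "B \<in> lie_algebra"
  show "A + B \<in> lie_algebra"
  proof (rule velocity_in_lie_algebra)
    \<comment> \<open>the curve \<open>exp (t A) exp (t B)\<close> in the group has velocity \<open>A + B\<close>\<close>
    have "((\<lambda>t. exp (t *\<^sub>R A) * exp (t *\<^sub>R B)) has_vector_derivative
        exp (0 *\<^sub>R A) * B + A * exp (0 *\<^sub>R B)) (at 0)"
      by (intro bounded_bilinear.has_vector_derivative[OF bounded_bilinear_mult]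
          exp_has_vector_derivative_0)
    then show "((\<lambda>t. exp (t *\<^sub>R A) * exp (t *\<^sub>R B)) has_vector_derivative A + B) (at 0)"
      by (simp add: add.commute)
  qed (use AB mult_mem in \<open>auto simp: lie_algebra_def\<close>)
qed

lemma continuous_on_exp_algebra: "continuous_on S (exp :: 'e \<Rightarrow> 'e)"
proof (rule continuous_on_subset[OF _ subset_UNIV])
  have "isCont exp A" for A :: 'e
  proof -
    let ?r = "norm A + 1"
    have "\<forall>\<^sub>F B in at A. norm (B - A) < 1"
      using eventually_at_ball[of 1 A UNIV] by (auto simp: dist_norm norm_minus_commute elim: eventually_mono)
    then have "\<forall>\<^sub>F B in at A. norm (exp B - exp A) \<le> exp ?r * norm (B - A)"
    proof eventually_elim
      case (elim B)
      then have "norm B \<le> ?r" using norm_triangle_ineq[of A "B - A"] by simp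
      then have "norm (exp B - exp A - (B - A)) \<le> (exp ?r - 1) * norm (B - A)"
        by (rule exp_strict_derivative_bound) simp
      then show ?case
        using norm_triangle_ineq[of "exp B - exp A - (B - A)" "B - A"] by (simp add: algebra_simps)
    qed
    moreover have "((\<lambda>B. exp ?r * norm (B - A)) \<longlongrightarrow> 0) (at A)"
      by (intro tendsto_mult_right_zero tendsto_norm_zero LIM_zero tendsto_ident_at)
    ultimately have "((\<lambda>B. exp B - exp A) \<longlongrightarrow> 0) (at A)"
      by (rule Lim_null_comparison)
    then show ?thesis
      unfolding isCont_def by (rule LIM_zero_cancel)
  qed
  then show "continuous_on UNIV (exp :: 'e \<Rightarrow> 'e)"
    by (simp add: continuous_at_imp_continuous_on)
qed

lemma closed_lie_algebra: "closed lie_algebra"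
proof -
  have "lie_algebra = (\<Inter>t. (\<lambda>A. exp (t *\<^sub>R A)) -` G)"
    by (auto simp: lie_algebra_def)
  moreover have "closed ((\<lambda>A. exp (t *\<^sub>R A)) -` G)" for t
  proof (rule closed_vimage[OF closed])
    have "continuous_on UNIV (exp \<circ> (\<lambda>A::'e. t *\<^sub>R A))"
      by (intro continuous_on_compose continuous_intros continuous_on_exp_algebra)
    then show "continuous_on UNIV (\<lambda>A. exp (t *\<^sub>R A :: 'e))" by (simp add: o_def)
  qed
  ultimately show ?thesis by auto
qed

lemma bounded_sequence_convergent_subsequence:
  fixes x :: "nat \<Rightarrow> 'e"
  assumes "\<And>n. norm (x n) \<le> c"
  obtains l r where "strict_mono (r :: nat \<Rightarrow> nat)" "(x \<circ> r) \<longlonglongrightarrow> l"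
proof -
  have "seq_compact (cball (0::'e) c)"
    using compact_cball_finite_dimensional[OF finite_dim] by (rule compact_imp_seq_compact)
  moreover have "\<forall>n. x n \<in> cball 0 c" using assms by simp
  ultimately show ?thesis using that unfolding seq_compact_def by blast
qed

lemma nearest_point:
  fixes a :: 'e
  assumes "closed S" "s \<in> S"
  obtains m where "m \<in> S" "\<And>x. x \<in> S \<Longrightarrow> norm (m - a) \<le> norm (x - a)"
proof -
  define K where "K = S \<inter> cball 0 (norm a + norm (s - a))"
  have "compact K"
    unfolding K_def
    by (rule closed_Int_compact[OF assms(1) compact_cball_finite_dimensional[OF finite_dim]])
  moreover have *: "x \<in> K" if "x \<in> S" "norm (x - a) \<le> norm (s - a)" for x
    using that norm_triangle_ineq[of a "x - a"] by (simp add: K_def)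
  moreover have "s \<in> K" using * assms(2) by simp
  moreover have "continuous_on K (\<lambda>x. norm (x - a))" by (intro continuous_intros)
  ultimately have "\<exists>m\<in>K. \<forall>x\<in>K. norm (m - a) \<le> norm (x - a)"
    by (intro continuous_attains_inf) auto
  then obtain m where m: "m \<in> K" "\<And>x. x \<in> K \<Longrightarrow> norm (m - a) \<le> norm (x - a)"
    by blast
  show ?thesis
  proof
    show "m \<in> S" using m(1) by (simp add: K_def)
    fix x assume "x \<in> S"
    show "norm (m - a) \<le> norm (x - a)"
    proof (cases "norm (x - a) \<le> norm (s - a)")
      case True
      then show ?thesis using m(2) * \<open>x \<in> S\<close> by blast
    next
      case False
      then show ?thesis using m(2)[OF \<open>s \<in> K\<close>] by simp
    qed
  qed
qed

text \<open>The functionals \<open>\<Lambda> i\<close> describe a point of an orbit: their common kernel is a left ideal, so that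
  the \<open>h\<close> in the group with \<open>\<Lambda> i h = \<Lambda> i 1\<close> form the stabilizer \<open>H\<close> of the base point, and \<open>\<Lambda> i (g h) =
  \<Lambda> i g\<close> for \<open>h \<in> H\<close>. The points of the orbit given by \<open>g n\<close> approach the base point with velocity
  \<open>u\<close>, although \<open>g n\<close> itself need not approach \<open>1\<close>.

  Replace \<open>g n\<close> by the element \<open>M n\<close> of the same coset of \<open>H\<close> that is nearest to \<open>1\<close>. If a
  subsequence of \<open>g\<close> tends to \<open>l\<close>, then \<open>l \<in> H\<close>, and comparison with \<open>g n * inverse l\<close> shows
  \<open>M n \<rightarrow> 1\<close> along that subsequence. The distance of \<open>M n\<close> to \<open>1\<close> is \<open>O(t n)\<close>: otherwise \<open>M n\<close> would
  approach \<open>1\<close> in a unit direction \<open>N0\<close> on which all \<open>\<Lambda> i\<close> vanish, and moving \<open>M n\<close> within its coset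
  by \<open>exp (- e n N0) \<in> H\<close>, where \<open>e n\<close> is that distance, would bring it closer to \<open>1\<close>. So
  \<open>(M n - 1) / t n\<close> is bounded, and any limit of it is the \<open>A\<close> sought.\<close>

lemma orbit_velocity_in_lie_algebra:
  fixes \<Lambda> :: "'i \<Rightarrow> 'e \<Rightarrow> real"
  assumes lin: "\<And>i. bounded_linear (\<Lambda> i)"
    and ideal: "\<And>m n i. (\<And>j. \<Lambda> j m = 0) \<Longrightarrow> \<Lambda> i (n * m) = 0"
    and g: "\<And>n. g n \<in> G" and bound: "\<And>n. norm (g n) \<le> c"
    and t: "\<And>n. t n > 0" "t \<longlonglongrightarrow> 0"
    and lim: "\<And>i. (\<lambda>n. (\<Lambda> i (g n) - \<Lambda> i 1) / t n) \<longlonglongrightarrow> u i"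
  obtains A where "A \<in> lie_algebra" "\<And>i. \<Lambda> i A = u i"
proof -
  define H where "H = {h \<in> G. \<forall>i. \<Lambda> i h = \<Lambda> i 1}"
  note diff = linear_diff[OF bounded_linear.linear[OF lin]]
    and scale = linear_scale[OF bounded_linear.linear[OF lin]]
  have same: "\<Lambda> i (m * h) = \<Lambda> i m" if "h \<in> H" for m h i
  proof -
    have "\<Lambda> i (m * (h - 1)) = 0"
      by (rule ideal) (use that in \<open>simp add: H_def diff\<close>)
    then show ?thesis by (simp add: right_diff_distrib diff)
  qed
  have exp_H: "exp N \<in> H" if N: "N \<in> lie_algebra" "\<And>i. \<Lambda> i N = 0" for N
  proof -
    have "\<Lambda> i (exp N) = \<Lambda> i 1" for i
    proof -
      have "(\<lambda>k. \<Lambda> i (N ^ k /\<^sub>R fact k)) sums \<Lambda> i (exp N)"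
        by (rule bounded_linear.sums[OF lin exp_converges])
      moreover have "\<Lambda> i (N ^ k /\<^sub>R fact k) = (if k = 0 then \<Lambda> i 1 else 0)" for k
      proof (cases k)
        case (Suc j)
        have "\<Lambda> i (N ^ j * N) = 0" by (rule ideal) (rule N)
        then show ?thesis
          using Suc by (simp add: scale power_commutes del: fact_Suc)
      qed simp
      ultimately show ?thesis
        using sums_single[of 0 "\<lambda>_. \<Lambda> i 1"] by (simp add: sums_iff)
    qed
    moreover have "exp N \<in> G"
      using N(1) unfolding lie_algebra_def by (metis (mono_tags, lifting) mem_Collect_eq scaleR_one)
    ultimately show ?thesis by (simp add: H_def)
  qed
  have closed_fibre: "closed {m \<in> G. \<forall>i. \<Lambda> i m = a i}" for a
  proof -
    have "closed {m. \<Lambda> i m = a i}" for i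
      using linear_continuous_on[OF lin] by (intro closed_Collect_eq continuous_intros)
    then have "closed (G \<inter> (\<Inter>i. {m. \<Lambda> i m = a i}))"
      using closed by (intro closed_Int closed_INT) auto
    moreover have "G \<inter> (\<Inter>i. {m. \<Lambda> i m = a i}) = {m \<in> G. \<forall>i. \<Lambda> i m = a i}" by auto
    ultimately show ?thesis by simp
  qed
  define F where "F n = {m \<in> G. \<forall>i. \<Lambda> i m = \<Lambda> i (g n)}" for n
  have "\<exists>m. m \<in> F n \<and> (\<forall>x\<in>F n. norm (m - 1) \<le> norm (x - 1))" for n
  proof -
    have "closed (F n)" unfolding F_def by (rule closed_fibre)
    moreover have "g n \<in> F n" using g by (simp add: F_def)
    ultimately show ?thesis by (metis nearest_point)
  qed
  then obtain M where M: "\<And>n. M n \<in> F n" "\<And>n x. x \<in> F n \<Longrightarrow> norm (M n - 1) \<le> norm (x - 1)"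
    by metis
  have M_G: "M n \<in> G" and M_L: "\<Lambda> i (M n) = \<Lambda> i (g n)" for n i
    using M(1)[of n] by (auto simp: F_def)
  have F_H: "x * h \<in> F n" if "x \<in> F n" "h \<in> H" for x h n
    using that same mult_mem by (auto simp: F_def H_def)
  obtain l r where r: "strict_mono (r :: nat \<Rightarrow> nat)" and l: "(g \<circ> r) \<longlonglongrightarrow> l"
    by (rule bounded_sequence_convergent_subsequence[OF bound])
  have tr: "(t \<circ> r) \<longlonglongrightarrow> 0" using LIMSEQ_subseq_LIMSEQ[OF t(2) r] .
  have "\<Lambda> i l = \<Lambda> i 1" for i
  proof -
    have "(\<lambda>n. t n * ((\<Lambda> i (g n) - \<Lambda> i 1) / t n)) \<longlonglongrightarrow> 0 * u i"
      by (intro tendsto_mult t lim)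
    then have "(\<lambda>n. \<Lambda> i (g n) - \<Lambda> i 1) \<longlonglongrightarrow> 0"
      using t(1)[THEN less_imp_neq] by (simp add: less_imp_neq[symmetric])
    then have "(\<lambda>n. \<Lambda> i (g n)) \<longlonglongrightarrow> \<Lambda> i 1" by (rule LIM_zero_cancel)
    then have "(\<lambda>n. \<Lambda> i ((g \<circ> r) n)) \<longlonglongrightarrow> \<Lambda> i 1"
      using LIMSEQ_subseq_LIMSEQ[OF _ r] by (fastforce simp: o_def)
    moreover have "(\<lambda>n. \<Lambda> i ((g \<circ> r) n)) \<longlonglongrightarrow> \<Lambda> i l"
      by (rule bounded_linear.tendsto[OF lin l])
    ultimately show ?thesis by (rule LIMSEQ_unique[symmetric])
  qed
  moreover have "l \<in> G"
    using closed_sequentially[OF closed _ l] g by simp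
  ultimately have "l \<in> H" by (simp add: H_def)
  obtain l' where l': "l' \<in> G" "l * l' = 1" "l' * l = 1"
    using inverse_mem[OF \<open>l \<in> G\<close>] by blast
  have "l' \<in> H"
    using same[OF \<open>l \<in> H\<close>, of _ l'] l' by (simp add: H_def)
  define e where "e n = norm (M (r n) - 1)" for n
  have e0: "e \<longlonglongrightarrow> 0"
  proof (rule tendsto_sandwich[OF _ _ tendsto_const])
    have "e n \<le> norm (g (r n) * l' - 1)" for n
      unfolding e_def by (intro M(2) F_H \<open>l' \<in> H\<close>) (simp add: F_def g)
    then show "\<forall>\<^sub>F n in sequentially. e n \<le> norm (g (r n) * l' - 1)" by simp
    have "(\<lambda>n. (g \<circ> r) n * l') \<longlonglongrightarrow> l * l'"
      by (intro tendsto_mult l tendsto_const)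
    then have "(\<lambda>n. g (r n) * l' - 1) \<longlonglongrightarrow> 0"
      using l' by (simp add: LIM_zero_iff)
    then show "(\<lambda>n. norm (g (r n) * l' - 1)) \<longlonglongrightarrow> 0" by (rule tendsto_norm_zero)
  qed (simp add: e_def)
  have M1: "(\<lambda>n. M (r n)) \<longlonglongrightarrow> 1"
    using e0 unfolding e_def by (simp add: tendsto_norm_zero_iff LIM_zero_iff)
  \<comment> \<open>if the distance were not \<open>O(t)\<close>, the nearest points could be improved\<close>
  have "\<exists>k. \<forall>n\<ge>k. e n \<le> real k * t (r n)"
  proof (rule ccontr)
    assume "\<not> ?thesis"
    then have "\<forall>k. \<exists>n\<ge>k. e n > real k * t (r n)" by (meson not_le)
    then obtain s where s: "\<And>k. s k \<ge> k" "\<And>k. e (s k) > real k * t (r (s k))" by metis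
    have s_top: "filterlim s at_top sequentially"
      using s(1) by (rule filterlim_at_top_mono[OF filterlim_ident, OF always_eventually, OF allI])
    have e_pos: "e (s k) > 0" for k
      using s(2)[of k] t(1)[of "r (s k)"] by (meson le_less_trans less_imp_le mult_nonneg_nonneg of_nat_0_le_iff)
    define N where "N k = (M (r (s k)) - 1) /\<^sub>R e (s k)" for k
    have N1: "norm (N k) = 1" for k
      using e_pos[of k] by (simp add: N_def e_def)
    obtain N0 q where q: "strict_mono (q :: nat \<Rightarrow> nat)" and N0: "(N \<circ> q) \<longlonglongrightarrow> N0"
      by (rule bounded_sequence_convergent_subsequence[OF eq_refl[OF N1]])
    have sq: "filterlim (\<lambda>k. s (q k)) at_top sequentially"
      by (rule filterlim_compose[OF s_top filterlim_subseq[OF q]])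
    have "norm N0 = 1"
      using tendsto_norm[OF N0] N1 LIMSEQ_unique[OF _ tendsto_const] by (simp add: o_def)
    have esq: "(\<lambda>k. e (s (q k))) \<longlonglongrightarrow> 0" by (rule filterlim_compose[OF e0 sq])
    have N0_lie: "N0 \<in> lie_algebra"
      by (rule limit_direction_in_lie_algebra[OF M_G e_pos esq])
        (use N0 in \<open>simp add: N_def o_def\<close>)
    have "\<Lambda> i N0 = 0" for i
    proof -
      have "(\<lambda>k. \<Lambda> i ((N \<circ> q) k)) \<longlonglongrightarrow> 0"
      proof (rule Lim_null_comparison)
        have lim': "(\<lambda>k. (\<Lambda> i (g (r (s (q k)))) - \<Lambda> i 1) / t (r (s (q k)))) \<longlonglongrightarrow> u i"
          by (rule filterlim_compose[OF lim])
            (rule filterlim_compose[OF filterlim_subseq[OF r] sq])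
        have "(\<lambda>k. 1 / real (q k)) \<longlonglongrightarrow> 0"
          using LIMSEQ_subseq_LIMSEQ[OF lim_1_over_n q] by (simp add: o_def)
        from tendsto_mult[OF this tendsto_norm[OF lim']]
        show "(\<lambda>k. 1 / real (q k) * norm ((\<Lambda> i (g (r (s (q k)))) - \<Lambda> i 1) / t (r (s (q k))))) \<longlonglongrightarrow> 0"
          by simp
        show "\<forall>\<^sub>F k in sequentially. norm (\<Lambda> i ((N \<circ> q) k))
          \<le> 1 / real (q k) * norm ((\<Lambda> i (g (r (s (q k)))) - \<Lambda> i 1) / t (r (s (q k))))"
        proof (rule eventually_mono[OF eventually_gt_at_top[of 0]])
          fix k :: nat assume "0 < k"
          then have qk: "q k > 0" using strict_mono_imp_increasing[OF q, of k] by linarith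
          let ?n = "r (s (q k))"
          have "\<Lambda> i ((N \<circ> q) k) = (\<Lambda> i (g ?n) - \<Lambda> i 1) / e (s (q k))"
            by (simp add: N_def scale diff M_L divide_inverse_commute)
          then have "norm (\<Lambda> i ((N \<circ> q) k)) = \<bar>\<Lambda> i (g ?n) - \<Lambda> i 1\<bar> / e (s (q k))"
            using e_pos[of "q k"] by (simp add: abs_divide)
          also have "\<dots> \<le> \<bar>\<Lambda> i (g ?n) - \<Lambda> i 1\<bar> / (real (q k) * t ?n)"
            using s(2)[of "q k"] t(1)[of ?n] qk e_pos[of "q k"]
            by (intro divide_left_mono mult_pos_pos) auto
          also have "\<dots> = 1 / real (q k) * norm ((\<Lambda> i (g ?n) - \<Lambda> i 1) / t ?n)"
            using t(1)[of ?n] by (simp add: abs_divide)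
          finally show "norm (\<Lambda> i ((N \<circ> q) k))
            \<le> 1 / real (q k) * norm ((\<Lambda> i (g ?n) - \<Lambda> i 1) / t ?n)" .
        qed
      qed
      moreover have "(\<lambda>k. \<Lambda> i ((N \<circ> q) k)) \<longlonglongrightarrow> \<Lambda> i N0"
        by (rule bounded_linear.tendsto[OF lin N0])
      ultimately show ?thesis by (rule LIMSEQ_unique[symmetric])
    qed
    then have exp_N0: "exp ((- x) *\<^sub>R N0) \<in> H" for x
      by (intro exp_H subspace_scale[OF subspace_lie_algebra N0_lie])
        (simp add: scale del: scaleR_minus_left)
    define P where "P k = (M (r (s (q k))) * exp ((- e (s (q k))) *\<^sub>R N0) - 1) /\<^sub>R e (s (q k))" for k
    \<comment> \<open>minimality of the distance, rescaled\<close>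
    have "norm (P k) \<ge> 1" for k
    proof -
      have "e (s (q k)) \<le> norm (M (r (s (q k))) * exp ((- e (s (q k))) *\<^sub>R N0) - 1)"
        unfolding e_def[of "s (q k)"] by (intro M(2) F_H M(1) exp_N0)
      then have "1 \<le> norm (M (r (s (q k))) * exp ((- e (s (q k))) *\<^sub>R N0) - 1) / e (s (q k))"
        using e_pos[of "q k"] by simp
      then show ?thesis
        using e_pos[of "q k"] unfolding P_def norm_scaleR by (simp add: divide_inverse_commute)
    qed
    \<comment> \<open>to first order, multiplication by \<open>exp (- e N0)\<close> removes the whole displacement\<close>
    moreover have "P \<longlonglongrightarrow> 0"
    proof -
      have "(\<lambda>k. (exp ((- e (s (q k))) *\<^sub>R N0) - 1) /\<^sub>R (- e (s (q k)))) \<longlonglongrightarrow> N0"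
        using has_vector_derivative_imp_sequence[OF exp_has_vector_derivative_0[of N0], of "\<lambda>k. - e (s (q k))"]
          tendsto_minus[OF esq] e_pos by (simp add: less_imp_neq[symmetric])
      moreover have "(\<lambda>k. M (r (s (q k)))) \<longlonglongrightarrow> 1"
        by (rule filterlim_compose[OF M1 sq])
      ultimately have "(\<lambda>k. (N \<circ> q) k - M (r (s (q k))) * ((exp ((- e (s (q k))) *\<^sub>R N0) - 1) /\<^sub>R (- e (s (q k)))))
          \<longlonglongrightarrow> N0 - 1 * N0"
        by (intro tendsto_intros N0)
      moreover have "(N \<circ> q) k - M (r (s (q k))) * ((exp ((- e (s (q k))) *\<^sub>R N0) - 1) /\<^sub>R (- e (s (q k)))) = P k" for k
        by (simp add: N_def P_def algebra_simps)
      ultimately show ?thesis by simp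
    qed
    ultimately show False
      using LIMSEQ_le_const[OF tendsto_norm[of P 0]] by fastforce
  qed
  then obtain k where k: "\<And>n. n \<ge> k \<Longrightarrow> e n \<le> real k * t (r n)" by blast
  define Q where "Q n = (M (r (n + k)) - 1) /\<^sub>R t (r (n + k))" for n
  have Q_bound: "norm (Q n) \<le> real k" for n
    using k[of "n + k"] t(1)[of "r (n + k)"] unfolding Q_def e_def norm_scaleR
    by (simp add: field_simps)
  obtain A q where q: "strict_mono (q :: nat \<Rightarrow> nat)" and A: "(Q \<circ> q) \<longlonglongrightarrow> A"
    by (rule bounded_sequence_convergent_subsequence[OF Q_bound])
  have qk: "filterlim (\<lambda>n. r (q n + k)) at_top sequentially"
    by (intro filterlim_compose[OF filterlim_subseq[OF r]] filterlim_compose[OF filterlim_add_const_nat_at_top]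
        filterlim_subseq q)
  show ?thesis
  proof
    show "A \<in> lie_algebra"
      by (rule limit_direction_in_lie_algebra[OF M_G t(1) filterlim_compose[OF t(2) qk]])
        (use A in \<open>simp add: Q_def o_def\<close>)
    fix i
    have "(\<lambda>n. \<Lambda> i ((Q \<circ> q) n)) \<longlonglongrightarrow> \<Lambda> i A"
      by (rule bounded_linear.tendsto[OF lin A])
    moreover have "\<Lambda> i ((Q \<circ> q) n) = (\<Lambda> i (g (r (q n + k))) - \<Lambda> i 1) / t (r (q n + k))" for n
      by (simp add: Q_def scale diff M_L divide_inverse_commute)
    ultimately show "\<Lambda> i A = u i"
      using LIMSEQ_unique filterlim_compose[OF lim[of i] qk] by simp
  qed
qed

text \<open>Otherwise there are \<open>m n \<rightarrow> 1\<close> in the group outside the image. Let \<open>exp (A n)\<close> be the point of the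
  image nearest to \<open>m n\<close>, at distance \<open>e n > 0\<close>. The directions \<open>(m n - exp (A n)) / e n\<close> have a limit
  \<open>N0\<close> in the Lie algebra, and by strict differentiability \<open>exp (A n + e n N0)\<close> is nearer to \<open>m n\<close>
  than \<open>exp (A n)\<close>.\<close>

lemma exp_covers_neighbourhood:
  assumes "d > 0"
  obtains \<rho> where "\<rho> > 0"
    "\<And>m. m \<in> G \<Longrightarrow> norm (m - 1) < \<rho> \<Longrightarrow> \<exists>A\<in>lie_algebra. norm A < d \<and> exp A = m"
proof (rule ccontr)
  assume *: "\<not> thesis"
  have "\<exists>m\<in>G. norm (m - 1) < 1 / real (Suc n) \<and> (\<forall>A\<in>lie_algebra. norm A < d \<longrightarrow> exp A \<noteq> m)" for n
    using * that[of "1 / real (Suc n)"] by fastforce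
  then obtain m where m: "\<And>n. m n \<in> G" "\<And>n. norm (m n - 1) < 1 / real (Suc n)"
    "\<And>n A. A \<in> lie_algebra \<Longrightarrow> norm A < d \<Longrightarrow> exp A \<noteq> m n" by metis
  \<comment> \<open>since \<open>exp (1/8) - 1 \<le> 1/4\<close>, the map \<open>A \<mapsto> exp A - A\<close> has Lipschitz constant \<open>1/4\<close> on the ball of this radius\<close>
  define \<delta> where "\<delta> = min d (1/8)"
  have \<delta>: "0 < \<delta>" "\<delta> \<le> d" "\<delta> \<le> 1/8" using assms by (auto simp: \<delta>_def)
  have strict: "norm (exp A - exp B - (A - B)) \<le> 1/4 * norm (A - B)"
    if "norm A \<le> \<delta>" "norm B \<le> \<delta>" for A B :: 'e
  proof -
    have "exp \<delta> - 1 \<le> 1/4"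
      using real_exp_bound_lemma[of \<delta>] \<delta> by simp
    then show ?thesis
      using exp_strict_derivative_bound[OF that] by (meson mult_right_mono norm_ge_zero order_trans)
  qed
  define L where "L = lie_algebra \<inter> cball 0 \<delta>"
  have L0: "0 \<in> L" using subspace_0[OF subspace_lie_algebra] \<delta> by (simp add: L_def)
  have "compact L"
    unfolding L_def
    by (rule closed_Int_compact[OF closed_lie_algebra compact_cball_finite_dimensional[OF finite_dim]])
  have "\<exists>A\<in>L. \<forall>B\<in>L. norm (m n - exp A) \<le> norm (m n - exp B)" for n
    by (rule continuous_attains_inf[OF \<open>compact L\<close>])
      (use L0 in \<open>auto intro!: continuous_intros continuous_on_exp_algebra\<close>)
  then obtain A where A: "\<And>n. A n \<in> L" "\<And>n B. B \<in> L \<Longrightarrow> norm (m n - exp (A n)) \<le> norm (m n - exp B)"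
    by metis
  have A_lie: "A n \<in> lie_algebra" and A_\<delta>: "norm (A n) \<le> \<delta>" for n
    using A(1)[of n] by (auto simp: L_def)
  define e where "e n = norm (m n - exp (A n))" for n
  have inv_n: "(\<lambda>n. 1 / real (Suc n)) \<longlonglongrightarrow> 0" by (rule LIMSEQ_Suc[OF lim_1_over_n])
  have e_le: "e n < 1 / real (Suc n)" for n
    using A(2)[OF L0, of n] m(2)[of n] by (simp add: e_def)
  have e0: "e \<longlonglongrightarrow> 0"
    by (rule tendsto_sandwich[OF _ _ tendsto_const inv_n])
      (use e_le in \<open>auto intro!: always_eventually less_imp_le simp: e_def\<close>)
  have A_bound: "norm (A n) \<le> 4 * (1 / real (Suc n))" for n
  proof -
    have "norm (exp (A n) - exp 0 - (A n - 0)) \<le> 1/4 * norm (A n - 0)"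
      by (rule strict) (use A_\<delta> \<delta> in auto)
    then have "norm (A n) \<le> norm (exp (A n) - 1) + 1/4 * norm (A n)"
      using norm_triangle_ineq4[of "exp (A n) - 1" "exp (A n) - 1 - A n"] by simp
    moreover have "norm (exp (A n) - 1) \<le> e n + norm (m n - 1)"
      using norm_triangle_ineq4[of "m n - 1" "m n - exp (A n)"] by (simp add: e_def)
    moreover define x where "x = 1 / real (Suc n)"
    ultimately have "norm (A n) \<le> 4 * x"
      using e_le[of n] m(2)[of n] norm_ge_zero[of "m n - 1"] unfolding x_def[symmetric] by linarith
    then show ?thesis unfolding x_def .
  qed
  have A0: "A \<longlonglongrightarrow> 0"
  proof (rule Lim_null_comparison)
    show "(\<lambda>n. 4 * (1 / real (Suc n))) \<longlonglongrightarrow> 0"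
      using tendsto_mult_right_zero[OF inv_n] by blast
  qed (use A_bound in auto)
  have expA: "(\<lambda>n. exp (- A n)) \<longlonglongrightarrow> 1"
    using continuous_on_tendsto_compose[OF continuous_on_exp_algebra[of UNIV] tendsto_minus[OF A0]] by simp
  obtain K where K: "\<And>n. n \<ge> K \<Longrightarrow> norm (A n) < \<delta>"
    using order_tendstoD(2)[OF tendsto_norm_zero[OF A0] \<delta>(1)] by (auto simp: eventually_sequentially)
  have e_pos: "e (n + K) > 0" for n
    using m(3)[OF A_lie, of "n + K" "n + K"] K[of "n + K"] \<delta> by (auto simp: e_def)
  define N where "N n = (m (n + K) - exp (A (n + K))) /\<^sub>R e (n + K)" for n
  have N1: "norm (N n) = 1" for n
    using e_pos[of n] by (simp add: N_def e_def)
  obtain N0 q where q: "strict_mono (q :: nat \<Rightarrow> nat)" and N0: "(N \<circ> q) \<longlonglongrightarrow> N0"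
    by (rule bounded_sequence_convergent_subsequence[OF eq_refl[OF N1]])
  have qK: "filterlim (\<lambda>n. q n + K) at_top sequentially"
    by (intro filterlim_compose[OF filterlim_add_const_nat_at_top] filterlim_subseq q)
  have n1: "norm N0 = 1"
    using tendsto_norm[OF N0] N1 LIMSEQ_unique[OF _ tendsto_const] by (simp add: o_def)
  have N0_lie: "N0 \<in> lie_algebra"
  proof (rule limit_direction_in_lie_algebra)
    show "exp (- A (q n + K)) * m (q n + K) \<in> G" for n
      using A_lie[of "q n + K"] unfolding lie_algebra_def
      by (intro mult_mem m(1)) (metis (mono_tags, lifting) mem_Collect_eq scaleR_minus1_left)
    show "e (q n + K) > 0" for n by (rule e_pos)
    show "(\<lambda>n. e (q n + K)) \<longlonglongrightarrow> 0" by (rule filterlim_compose[OF e0 qK])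
    have "(\<lambda>n. exp (- A (q n + K)) * (N \<circ> q) n) \<longlonglongrightarrow> 1 * N0"
      by (intro tendsto_mult N0 filterlim_compose[OF expA qK])
    then show "(\<lambda>n. (exp (- A (q n + K)) * m (q n + K) - 1) /\<^sub>R e (q n + K)) \<longlonglongrightarrow> N0"
      by (simp add: N_def right_diff_distrib exp_mult_exp_minus)
  qed
  have "(\<lambda>n. A (q n + K) + e (q n + K) *\<^sub>R N0) \<longlonglongrightarrow> 0 + 0 *\<^sub>R N0"
    by (intro tendsto_intros filterlim_compose[OF A0 qK] filterlim_compose[OF e0 qK])
  then have "\<forall>\<^sub>F n in sequentially. norm (A (q n + K) + e (q n + K) *\<^sub>R N0) < \<delta>"
    using \<delta>(1) by (intro order_tendstoD(2)[OF tendsto_norm]) auto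
  moreover have "\<forall>\<^sub>F n in sequentially. norm ((N \<circ> q) n - N0) < 1/2"
    using tendsto_norm[OF LIM_zero[OF N0]] by (rule order_tendstoD(2)) simp
  ultimately have "\<forall>\<^sub>F n in sequentially. norm (A (q n + K) + e (q n + K) *\<^sub>R N0) < \<delta> \<and> norm ((N \<circ> q) n - N0) < 1/2"
    by (rule eventually_conj)
  then obtain n where n: "norm (A (q n + K) + e (q n + K) *\<^sub>R N0) < \<delta>" "norm (N (q n) - N0) < 1/2"
    using eventually_happens'[OF sequentially_bot] by fastforce
  let ?j = "q n + K"
  let ?B = "A ?j + e ?j *\<^sub>R N0"
  have "?B \<in> L"
    using n(1) A_lie N0_lie subspace_lie_algebra by (simp add: L_def subspace_add subspace_scale)
  then have "e ?j \<le> norm (m ?j - exp ?B)"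
    unfolding e_def[of ?j] by (rule A(2))
  also have "m ?j - exp ?B = e ?j *\<^sub>R (N (q n) - N0) - (exp ?B - exp (A ?j) - (?B - A ?j))"
    using e_pos[of "q n"] by (simp add: N_def scaleR_diff_right)
  also have "norm \<dots> \<le> e ?j * norm (N (q n) - N0) + 1/4 * norm (?B - A ?j)"
    using strict[of ?B "A ?j"] n(1) A_\<delta> e_pos[of "q n"]
      norm_triangle_ineq4[of "e ?j *\<^sub>R (N (q n) - N0)" "exp ?B - exp (A ?j) - (?B - A ?j)"]
    by simp
  also have "\<dots> \<le> e ?j * (1/2) + 1/4 * e ?j"
    using n(2) e_pos[of "q n"] n1 by (intro add_mono mult_left_mono) auto
  finally show False using e_pos[of "q n"] by simp
qed

end

section \<open>The dimension of a manifold\<close>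

lemma Euclidean_space_eq_top_of_set: "Euclidean_space n = top_of_set {x. \<forall>i\<ge>n. x i = 0}"
  by (simp add: Euclidean_space_def euclidean_product_topology)

text \<open>Moving a point of the set in direction \<open>n\<close> leaves the smaller space at once.\<close>

lemma openin_Euclidean_space_subset_lower_dim:
  assumes V: "openin (Euclidean_space m) V" and sub: "V \<subseteq> topspace (Euclidean_space n)" and "n < m"
  shows "V = {}"
proof (rule ccontr)
  assume "V \<noteq> {}"
  then obtain y where y: "y \<in> V" by blast
  obtain T where T: "open T" "V = {x. \<forall>i\<ge>m. x i = 0} \<inter> T"
    using V unfolding Euclidean_space_eq_top_of_set openin_open by auto
  have cont: "continuous_on UNIV (\<lambda>s::real. y(n := y n + s))"
  proof (rule continuous_on_coordinatewise_then_product)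
    show "continuous_on UNIV (\<lambda>s. (y(n := y n + s)) i)" for i
      by (cases "i = n") (auto intro!: continuous_intros)
  qed
  have "open ((\<lambda>s. y(n := y n + s)) -` T)"
    by (rule open_vimage[OF T(1) cont])
  moreover have "0 \<in> (\<lambda>s. y(n := y n + s)) -` T" using y T by simp
  ultimately obtain e where e: "e > 0" "ball 0 e \<subseteq> (\<lambda>s. y(n := y n + s)) -` T"
    using open_contains_ball by metis
  then have "e / 2 \<in> (\<lambda>s. y(n := y n + s)) -` T" by (auto simp: subset_iff)
  then have "y(n := y n + e / 2) \<in> V"
    using y T \<open>n < m\<close> by simp
  then have "y(n := y n + e / 2) \<in> topspace (Euclidean_space n)" using sub by blast
  then have "y n + e / 2 = 0" unfolding topspace_Euclidean_space by (auto dest: spec[of _ n])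
  moreover have "y n = 0"
    using y sub unfolding topspace_Euclidean_space by blast
  ultimately show False using e by simp
qed

text \<open>Charts of dimensions \<open>m\<close> and \<open>n < m\<close> at the same point would give a continuous injection of a
  non-empty open subset of the larger space into the smaller one, whose image is open in the larger
  space by invariance of domain.\<close>

lemma locally_Euclidean_le:
  assumes m: "locally_Euclidean m T" and n: "locally_Euclidean n T" and ne: "topspace T \<noteq> {}"
  shows "m \<le> n"
proof (rule ccontr)
  assume "\<not> m \<le> n"
  then have "n < m" by simp
  obtain x where x: "x \<in> topspace T" using ne by blast
  obtain U W where U: "openin T U" "x \<in> U" "openin (Euclidean_space m) W"
    "subtopology T U homeomorphic_space subtopology (Euclidean_space m) W"
    using m x unfolding locally_Euclidean_def by blast
  obtain U' W' where U': "openin T U'" "x \<in> U'" "openin (Euclidean_space n) W'"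
    "subtopology T U' homeomorphic_space subtopology (Euclidean_space n) W'"
    using n x unfolding locally_Euclidean_def by blast
  have top: "topspace (subtopology T U) = U" "topspace (subtopology T U') = U'"
    "topspace (subtopology (Euclidean_space m) W) = W" "topspace (subtopology (Euclidean_space n) W') = W'"
    using U U' openin_subset by (metis topspace_subtopology_subset)+
  obtain f g where fg: "homeomorphic_maps (subtopology T U) (subtopology (Euclidean_space m) W) f g"
    using U(4) unfolding homeomorphic_space_def by blast
  obtain f' g' where fg': "homeomorphic_maps (subtopology T U') (subtopology (Euclidean_space n) W') f' g'"
    using U'(4) unfolding homeomorphic_space_def by blast
  have cont_f: "continuous_map (subtopology T U) (subtopology (Euclidean_space m) W) f"
    and cont_g: "continuous_map (subtopology (Euclidean_space m) W) (subtopology T U) g"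
    and gf: "\<And>u. u \<in> U \<Longrightarrow> g (f u) = u" and fg1: "\<And>w. w \<in> W \<Longrightarrow> f (g w) = w"
    using fg unfolding homeomorphic_maps_def top by blast+
  have cont_f': "continuous_map (subtopology T U') (subtopology (Euclidean_space n) W') f'"
    and gf': "\<And>u. u \<in> U' \<Longrightarrow> g' (f' u) = u"
    using fg' unfolding homeomorphic_maps_def top by blast+
  have fU: "f ` U \<subseteq> W" and f'U': "f' ` U' \<subseteq> W'"
    using continuous_map_image_subset_topspace[OF cont_f]
      continuous_map_image_subset_topspace[OF cont_f'] unfolding top by blast+
  define V where "V = {w \<in> W. g w \<in> U \<inter> U'}"
  have UU': "openin (subtopology T U) (U \<inter> U')"
    using U'(1) by (simp add: openin_subtopology_Int2)
  have V_open: "openin (Euclidean_space m) V"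
    using openin_continuous_map_preimage[OF cont_g UU'] U(3) unfolding V_def top
    by (rule openin_trans_full)
  have "f x \<in> V" using U(2) U'(2) fU gf by (auto simp: V_def)
  define \<phi> where "\<phi> = f' \<circ> g"
  have "continuous_map (subtopology (Euclidean_space m) V) (Euclidean_space n) \<phi>"
    unfolding \<phi>_def
  proof (rule continuous_map_compose)
    have "continuous_map (subtopology (Euclidean_space m) V) T g"
      using continuous_map_from_subtopology_mono[of "Euclidean_space m" W T g V]
        continuous_map_into_fulltopology[OF cont_g] by (auto simp: V_def)
    moreover have "g ` V \<subseteq> U'" by (auto simp: V_def)
    ultimately show "continuous_map (subtopology (Euclidean_space m) V) (subtopology T U') g"
      by (auto simp: continuous_map_in_subtopology)
    show "continuous_map (subtopology T U') (Euclidean_space n) f'"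
      by (rule continuous_map_into_fulltopology[OF cont_f'])
  qed
  moreover have "Euclidean_space n = subtopology (Euclidean_space m) (topspace (Euclidean_space n))"
    using \<open>n < m\<close> unfolding Euclidean_space_eq_top_of_set subtopology_subtopology
    by (auto intro!: arg_cong[where f = top_of_set])
  ultimately have "continuous_map (subtopology (Euclidean_space m) V) (Euclidean_space m) \<phi>"
    by (metis continuous_map_into_fulltopology)
  moreover have "inj_on \<phi> V"
    by (rule inj_on_inverseI[of _ "f \<circ> g'"]) (auto simp: V_def \<phi>_def gf' fg1)
  ultimately have "openin (Euclidean_space m) (\<phi> ` V)"
    by (rule invariance_of_domain_Euclidean_space[OF V_open])
  moreover have "\<phi> ` V \<subseteq> topspace (Euclidean_space n)"
    using f'U' openin_subset[OF U'(3)] by (auto simp: V_def \<phi>_def)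
  ultimately have "\<phi> ` V = {}"
    by (rule openin_Euclidean_space_subset_lower_dim) (rule \<open>n < m\<close>)
  with \<open>f x \<in> V\<close> show False by blast
qed

lemma manifold_dim_eq:
  assumes "locally_Euclidean n T" "topspace T \<noteq> {}"
  shows "manifold_dim T = n"
  unfolding manifold_dim_def
  by (rule the_equality) (use assms locally_Euclidean_le in \<open>blast intro: antisym\<close>)+

lemma locally_Euclidean_homeomorphic:
  assumes T: "locally_Euclidean n T" and h: "homeomorphic_map T' T h"
  shows "locally_Euclidean n T'"
  unfolding locally_Euclidean_def
proof
  fix x assume x: "x \<in> topspace T'"
  have "h x \<in> topspace T" using h x homeomorphic_imp_surjective_map by blast
  then obtain U W where U: "openin T U" "h x \<in> U" "openin (Euclidean_space n) W"
    "subtopology T U homeomorphic_space subtopology (Euclidean_space n) W"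
    using T unfolding locally_Euclidean_def by blast
  define U' where "U' = {y \<in> topspace T'. h y \<in> U}"
  have "openin T' U'"
    unfolding U'_def using h U(1) homeomorphic_imp_continuous_map openin_continuous_map_preimage by blast
  moreover have "h ` (topspace T' \<inter> U') = topspace T \<inter> U"
    using homeomorphic_imp_surjective_map[OF h] by (auto simp: U'_def)
  then have "homeomorphic_map (subtopology T' U') (subtopology T U) h"
    by (rule homeomorphic_map_subtopologies[OF h])
  then have "subtopology T' U' homeomorphic_space subtopology (Euclidean_space n) W"
    using U(4) homeomorphic_map_imp_homeomorphic_space homeomorphic_space_trans by blast
  moreover have "x \<in> U'" using x U(2) by (simp add: U'_def)
  ultimately show "\<exists>U W. openin T' U \<and> x \<in> U \<and> openin (Euclidean_space n) W \<and>
       subtopology T' U homeomorphic_space subtopology (Euclidean_space n) W"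
    using U(3) by blast
qed

lemma homeomorphism_imp_homeomorphic_map:
  "homeomorphism S T f g \<Longrightarrow> homeomorphic_map (top_of_set S) (top_of_set T) f"
  unfolding homeomorphic_map_maps homeomorphic_maps_def homeomorphism_def by auto

context closed_group
begin

lemma exp_mem:
  assumes "A \<in> lie_algebra"
  shows "exp A \<in> G"
proof -
  have "exp (1 *\<^sub>R A) \<in> G" using assms unfolding lie_algebra_def by blast
  then show ?thesis by simp
qed

text \<open>The chart is the logarithm in linear coordinates \<open>f\<close> on the Lie algebra. The map \<open>exp \<circ> f\<close> is
  injective on a small compact box \<open>Q\<close>, hence a homeomorphism onto its image, and the image of the
  interior of \<open>Q\<close> contains a neighbourhood of \<open>1\<close> in the group.\<close>

lemma identity_chart:
  obtains \<rho> W where "\<rho> > 0" "openin (Euclidean_space (dim lie_algebra)) W"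
    "top_of_set {m \<in> G. norm (m - 1) < \<rho>} homeomorphic_space
      subtopology (Euclidean_space (dim lie_algebra)) W"
proof -
  define n where "n = dim lie_algebra"
  obtain B where B: "B \<subseteq> lie_algebra" "independent B" "lie_algebra \<subseteq> span B" "card B = n"
    using basis_exists unfolding n_def by blast
  obtain C :: "'e set" where C: "finite C" "UNIV \<subseteq> span C"
    using finite_dim unfolding finite_dimensional_def by blast
  have "B \<subseteq> span C" using C(2) by blast
  then have finB: "finite B"
    using independent_span_bound[OF C(1) B(2)] by simp
  have spanB: "span B = lie_algebra"
    using B span_minimal[OF B(1) subspace_lie_algebra] by blast
  obtain b where b: "bij_betw b {..<n} B"
    using bij_betw_from_nat_into_finite[OF finB] B(4) by auto
  define f where "f x = (\<Sum>i<n. x i *\<^sub>R b i)" for x :: "nat \<Rightarrow> real"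
  have f_alt: "f x = (\<Sum>v\<in>B. x (the_inv_into {..<n} b v) *\<^sub>R v)" for x
    unfolding f_def using b
    by (subst sum.reindex_bij_betw[OF b, symmetric]) (auto intro!: sum.cong simp: bij_betw_def the_inv_into_f_f)
  obtain c where c: "c > 0" "\<And>a. (\<Sum>v\<in>B. \<bar>a v\<bar>) \<le> c * norm (\<Sum>v\<in>B. a v *\<^sub>R v)"
    using coefficient_bound[OF finB B(2)] by blast
  have coord: "\<bar>x i\<bar> \<le> c * norm (f x)" if "i < n" for x i
  proof -
    have "\<bar>x i\<bar> \<le> (\<Sum>j<n. \<bar>x j\<bar>)"
      using member_le_sum[of i "{..<n}" "\<lambda>j. \<bar>x j\<bar>"] that by simp
    also have "\<dots> = (\<Sum>v\<in>B. \<bar>x (the_inv_into {..<n} b v)\<bar>)"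
      using b by (subst sum.reindex_bij_betw[OF b, symmetric])
        (auto intro!: sum.cong simp: bij_betw_def the_inv_into_f_f)
    also have "\<dots> \<le> c * norm (f x)" unfolding f_alt by (rule c(2))
    finally show ?thesis .
  qed
  have f_lie: "f x \<in> lie_algebra" for x
    unfolding f_def using b B(1)
    by (intro subspace_sum subspace_scale subspace_lie_algebra) (auto simp: bij_betw_def)
  have f_surj: "\<exists>x. (\<forall>i\<ge>n. x i = 0) \<and> f x = A" if "A \<in> lie_algebra" for A
  proof -
    define x where "x i = (if i < n then representation B A (b i) else 0)" for i
    have "f x = (\<Sum>i<n. representation B A (b i) *\<^sub>R b i)"
      by (simp add: f_def x_def)
    also have "\<dots> = (\<Sum>v\<in>B. representation B A v *\<^sub>R v)"
      by (rule sum.reindex_bij_betw[OF b])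
    also have "\<dots> = A"
      by (rule sum_representation_eq[OF B(2) _ finB subset_refl]) (use that spanB in simp)
    finally show ?thesis by (intro exI[of _ x]) (simp add: x_def)
  qed
  define K where "K = (\<Sum>i<n. norm (b i))"
  have K0: "K \<ge> 0" by (simp add: K_def sum_nonneg)
  \<comment> \<open>the size of the box for which \<open>norm (f x) \<le> 1/8\<close>, where \<open>exp\<close> is injective\<close>
  define s where "s = 1 / (8 * (1 + K))"
  have s: "s > 0" "s * K \<le> 1/8" using K0 by (auto simp: s_def field_simps)
  define Q where "Q = {x :: nat \<Rightarrow> real. \<forall>i. x i \<in> (if i < n then {-s..s} else {0})}"
  have "compact Q" unfolding Q_def by (rule compact_Pi_UNIV) auto
  have f_small: "norm (f x) \<le> 1/8" if "x \<in> Q" for x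
  proof -
    have "norm (x i *\<^sub>R b i) \<le> s * norm (b i)" if "i < n" for i
    proof -
      have "x i \<in> {-s..s}" using \<open>x \<in> Q\<close> that unfolding Q_def by (auto dest: spec[of _ i])
      then have "\<bar>x i\<bar> \<le> s" by auto
      then show ?thesis by (simp add: mult_right_mono)
    qed
    then have "norm (f x) \<le> (\<Sum>i<n. s * norm (b i))"
      unfolding f_def by (intro sum_norm_le) auto
    also have "\<dots> \<le> 1/8" using s(2) by (simp add: K_def sum_distrib_left)
    finally show ?thesis .
  qed
  define h where "h x = exp (f x)" for x
  have cont: "continuous_on S h" for S
  proof -
    have "continuous_on S f" unfolding f_def by (intro continuous_intros)
    then have "continuous_on S (exp \<circ> f)"
      by (intro continuous_on_compose continuous_on_exp_algebra)
    then show ?thesis by (simp add: h_def [abs_def] o_def)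
  qed
  have inj: "inj_on h Q"
  proof (rule inj_onI)
    fix x y assume xy: "x \<in> Q" "y \<in> Q" "h x = h y"
    have "norm (exp (f x) - exp (f y) - (f x - f y)) \<le> (exp (1/8) - 1) * norm (f x - f y)"
      by (intro exp_strict_derivative_bound f_small xy)
    also have "\<dots> \<le> 1/4 * norm (f x - f y)"
      using real_exp_bound_lemma[of "1/8"] by (intro mult_right_mono) auto
    finally have "norm (f x - f y) \<le> 1/4 * norm (f x - f y)"
      using xy(3) by (simp add: h_def norm_minus_commute)
    then have "f x - f y = 0" by simp
    moreover have "f x - f y = f (\<lambda>i. x i - y i)"
      by (simp add: f_def sum_subtractf scaleR_diff_left)
    ultimately have "x i = y i" if "i < n" for i
      using coord[OF that, of "\<lambda>i. x i - y i"] by simp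
    moreover have "x i = y i" if "\<not> i < n" for i
      using xy(1,2) that unfolding Q_def by (auto dest!: spec[of _ i])
    ultimately show "x = y" by blast
  qed
  obtain g where hg: "homeomorphism Q (h ` Q) h g"
    using homeomorphism_compact[OF \<open>compact Q\<close> cont refl inj] by blast
  \<comment> \<open>elements of the Lie algebra of norm below \<open>s / c\<close> have coordinates below \<open>s\<close>\<close>
  have "s / c > 0" using s c by simp
  then obtain \<rho> where \<rho>: "\<rho> > 0"
    "\<And>m. m \<in> G \<Longrightarrow> norm (m - 1) < \<rho> \<Longrightarrow> \<exists>A\<in>lie_algebra. norm A < s / c \<and> exp A = m"
    by (rule exp_covers_neighbourhood) blast
  define U where "U = {m \<in> G. norm (m - 1) < \<rho>}"
  define O' where "O' = (\<Inter>i<n. {x :: nat \<Rightarrow> real. \<bar>x i\<bar> < s}) \<inter> {x. norm (h x - 1) < \<rho>}"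
  define W where "W = {x. \<forall>i\<ge>n. x i = 0} \<inter> O'"
  have "open O'"
    unfolding O'_def
    by (intro open_Int open_INT ballI open_Collect_less continuous_intros cont) auto
  then have W_open: "openin (Euclidean_space n) W"
    unfolding W_def Euclidean_space_eq_top_of_set by (rule openin_open_Int)
  have "W \<subseteq> Q"
  proof
    fix x assume x: "x \<in> W"
    have "x i \<in> (if i < n then {-s..s} else {0})" for i
    proof (cases "i < n")
      case True
      then have "\<bar>x i\<bar> < s" using x by (simp add: W_def O'_def)
      then show ?thesis using True by (simp add: abs_less_iff)
    next
      case False
      then show ?thesis using x by (simp add: W_def)
    qed
    then show "x \<in> Q" unfolding Q_def by blast
  qed
  have "h ` W = U"
  proof
    show "h ` W \<subseteq> U"
      using exp_mem[OF f_lie] unfolding W_def O'_def U_def h_def by blast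
    show "U \<subseteq> h ` W"
    proof
      fix m assume m: "m \<in> U"
      then obtain A where A: "A \<in> lie_algebra" "norm A < s / c" "exp A = m"
        using \<rho>(2) unfolding U_def by blast
      then obtain x where x: "\<forall>i\<ge>n. x i = 0" "f x = A" using f_surj by blast
      have "\<bar>x i\<bar> < s" if "i < n" for i
        using coord[OF that, of x] A(2) x(2) c(1) by (simp add: pos_less_divide_eq mult.commute)
      moreover have "h x = m" using A x by (simp add: h_def)
      ultimately have "x \<in> W" using m x by (auto simp: W_def O'_def U_def)
      with \<open>h x = m\<close> show "m \<in> h ` W" by blast
    qed
  qed
  then have "homeomorphism W U h g"
    using homeomorphism_of_subsets[OF hg \<open>W \<subseteq> Q\<close>] by blast
  then have "top_of_set W homeomorphic_space top_of_set U"
    by (intro homeomorphic_map_imp_homeomorphic_space homeomorphism_imp_homeomorphic_map)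
  moreover have "subtopology (Euclidean_space n) W = top_of_set W"
    unfolding Euclidean_space_eq_top_of_set subtopology_subtopology
    by (rule arg_cong[where f = top_of_set]) (auto simp: W_def)
  ultimately have "top_of_set U homeomorphic_space subtopology (Euclidean_space n) W"
    by (subst homeomorphic_space_sym) simp
  from that[OF \<rho>(1) W_open[unfolded n_def] this[unfolded n_def U_def]] show ?thesis .
qed

lemma locally_Euclidean_group: "locally_Euclidean (dim lie_algebra) (top_of_set G)"
  unfolding locally_Euclidean_def
proof
  fix x assume "x \<in> topspace (top_of_set G)"
  then have x: "x \<in> G" by simp
  obtain y where y: "y \<in> G" "x * y = 1" "y * x = 1" using inverse_mem[OF x] by blast
  obtain \<rho> W where \<rho>: "\<rho> > 0" and W: "openin (Euclidean_space (dim lie_algebra)) W"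
    "top_of_set {m \<in> G. norm (m - 1) < \<rho>} homeomorphic_space
      subtopology (Euclidean_space (dim lie_algebra)) W"
    by (rule identity_chart)
  define U where "U = {m \<in> G. norm (y * m - 1) < \<rho>}"
  have cancel: "x * (y * m) = m" "y * (x * m) = m" for m
    using y by (simp_all flip: mult.assoc)
  have "homeomorphism U {m \<in> G. norm (m - 1) < \<rho>} (\<lambda>m. y * m) (\<lambda>m. x * m)"
    unfolding homeomorphism_def U_def
  proof (intro conjI ballI continuous_intros)
    show "(\<lambda>m. y * m) ` {m \<in> G. norm (y * m - 1) < \<rho>} = {m \<in> G. norm (m - 1) < \<rho>}"
      using mult_mem x y cancel by (auto simp: image_iff) (metis)
    show "(\<lambda>m. x * m) ` {m \<in> G. norm (m - 1) < \<rho>} = {m \<in> G. norm (y * m - 1) < \<rho>}"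
      using mult_mem x y cancel by (auto simp: image_iff) (metis)
  qed (simp_all add: cancel)
  then have "top_of_set U homeomorphic_space subtopology (Euclidean_space (dim lie_algebra)) W"
    using W(2) homeomorphic_map_imp_homeomorphic_space homeomorphism_imp_homeomorphic_map
      homeomorphic_space_trans by blast
  moreover have "subtopology (top_of_set G) U = top_of_set U"
    unfolding subtopology_subtopology by (rule arg_cong[where f = top_of_set]) (auto simp: U_def)
  moreover have "openin (top_of_set G) U"
  proof -
    have "open {m. norm (y * m - 1) < \<rho>}"
      by (intro open_Collect_less continuous_intros)
    moreover have "U = G \<inter> {m. norm (y * m - 1) < \<rho>}" by (auto simp: U_def)
    ultimately show ?thesis by (simp add: openin_open_Int)
  qed
  moreover have "x \<in> U" using x y \<rho> by (simp add: U_def)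
  ultimately show "\<exists>U W. openin (top_of_set G) U \<and> x \<in> U \<and> openin (Euclidean_space (dim lie_algebra)) W \<and>
       subtopology (top_of_set G) U homeomorphic_space subtopology (Euclidean_space (dim lie_algebra)) W"
    using W(1) by metis
qed

end

section \<open>Isometries are affine\<close>

lemma isometriesI:
  "surj g \<Longrightarrow> (\<And>x y. dist (g x) (g y) = dist x y) \<Longrightarrow> g \<in> isometries"
  by (simp add: isometries_def)

lemma isometries_dist: "g \<in> isometries \<Longrightarrow> dist (g x) (g y) = dist x y"
  by (simp add: isometries_def)

lemma isometries_bij: "g \<in> isometries \<Longrightarrow> bij g"
  unfolding isometries_def bij_def inj_def by (metis (mono_tags, lifting) dist_eq_0_iff mem_Collect_eq)

lemma isometries_id: "id \<in> isometries"
  by (simp add: isometries_def)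

lemma isometries_comp: "g \<in> isometries \<Longrightarrow> h \<in> isometries \<Longrightarrow> g \<circ> h \<in> isometries"
  by (intro isometriesI comp_surj) (simp_all add: isometries_def)

lemma isometries_inverse:
  assumes "g \<in> isometries"
  obtains k where "k \<in> isometries" "\<And>x. k (g x) = x" "\<And>x. g (k x) = x"
proof
  show g: "g (the_inv g x) = x" for x
    using isometries_bij[OF assms] by (simp add: bij_def f_the_inv_into_f)
  show "the_inv g (g x) = x" for x
    using isometries_bij[OF assms] by (simp add: bij_def the_inv_f_f)
  then show "the_inv g \<in> isometries"
    by (metis g assms isometriesI isometries_dist surjI)
qed

lemma point_reflection_isometry: "(\<lambda>x. c - x) \<in> isometries" for c :: "'a::real_normed_vector"
proof (rule isometriesI)
  show "surj (\<lambda>x. c - x)" by (rule surjI[of _ "\<lambda>x. c - x"]) simp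
qed (simp add: dist_norm norm_minus_commute)

text \<open>Vaisala's argument. Let \<open>\<psi>\<close> be the reflection in the midpoint \<open>z\<close>. If \<open>h\<close> fixes \<open>a\<close> and \<open>b\<close>, then so
  does the isometry \<open>\<psi> h\<^sup>-\<^sup>1 \<psi> h\<close>, and it moves \<open>z\<close> twice as far as \<open>h\<close> does. Iterating, \<open>z\<close> would be moved
  arbitrarily far, but an isometry fixing \<open>a\<close> moves \<open>z\<close> by at most twice the distance to \<open>a\<close>.\<close>

lemma isometry_fixes_midpoint:
  fixes a b :: "'a::real_normed_vector"
  assumes "g \<in> isometries" "g a = a" "g b = b"
  shows "g ((1/2) *\<^sub>R (a + b)) = (1/2) *\<^sub>R (a + b)"
proof (rule ccontr)
  define z where "z = (1/2) *\<^sub>R (a + b)"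
  define W where "W = {h \<in> isometries. h a = a \<and> h b = b}"
  define D where "D h = norm (h z - z)" for h
  have bound: "D h \<le> 2 * norm (z - a)" if "h \<in> W" for h
  proof -
    have "norm (h z - a) = norm (z - a)"
      using that isometries_dist[of h z a] by (simp add: W_def dist_norm)
    then show ?thesis
      using norm_triangle_ineq4[of "h z - a" "z - a"] by (simp add: D_def)
  qed
  have double: "\<exists>k\<in>W. D k = 2 * D h" if "h \<in> W" for h
  proof -
    define \<psi> where "\<psi> x = (a + b) - x" for x
    have \<psi>: "\<psi> \<in> isometries" unfolding \<psi>_def by (rule point_reflection_isometry)
    have h: "h \<in> isometries" "h a = a" "h b = b" using that by (auto simp: W_def)
    obtain h' where h': "h' \<in> isometries" and inv_h: "\<And>x. h' (h x) = x"
      by (rule isometries_inverse[OF h(1)]) blast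
    have z_fix: "\<psi> z = z"
    proof -
      have "z + z = a + b" unfolding z_def scaleR_2[symmetric] by simp
      then show ?thesis by (simp add: \<psi>_def flip: eq_diff_eq)
    qed
    define k where "k = \<psi> \<circ> (h' \<circ> (\<psi> \<circ> h))"
    have "k \<in> isometries"
      unfolding k_def by (intro isometries_comp h' \<psi> h)
    moreover have "k a = a" "k b = b"
      using inv_h[of a] inv_h[of b] h by (simp_all add: k_def \<psi>_def)
    ultimately have "k \<in> W" by (simp add: W_def)
    have "D k = dist (\<psi> (h' (\<psi> (h z)))) (\<psi> z)"
      by (simp add: D_def k_def z_fix dist_norm)
    also have "\<dots> = dist (h' (\<psi> (h z))) (h' (h z))"
      by (simp add: isometries_dist[OF \<psi>] inv_h)
    also have "\<dots> = dist (\<psi> (h z)) (h z)"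
      by (rule isometries_dist[OF h'])
    also have "\<psi> (h z) - h z = - (2 *\<^sub>R (h z - z))"
      using z_fix by (simp add: \<psi>_def scaleR_2 algebra_simps)
    then have "dist (\<psi> (h z)) (h z) = 2 * D h"
      by (simp add: D_def dist_norm)
    finally show ?thesis using \<open>k \<in> W\<close> by blast
  qed
  have g: "g \<in> W" using assms by (simp add: W_def)
  have iter: "\<exists>h\<in>W. D h = 2 ^ n * D g" for n
  proof (induction n)
    case 0
    then show ?case using g by auto
  next
    case (Suc n)
    then obtain h where "h \<in> W" "D h = 2 ^ n * D g" by blast
    with double[of h] show ?case by (auto simp: mult.assoc)
  qed
  assume "g ((1/2) *\<^sub>R (a + b)) \<noteq> (1/2) *\<^sub>R (a + b)"
  then have "D g > 0" by (simp add: D_def z_def)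
  obtain n where "2 * norm (z - a) / D g < 2 ^ n"
    using real_arch_pow[of 2] by auto
  then have "2 * norm (z - a) < 2 ^ n * D g"
    using \<open>D g > 0\<close> by (simp add: field_simps)
  with iter[of n] bound show False by fastforce
qed

text \<open>Composing \<open>g\<close> with the reflections in the two midpoints, and with the inverse of \<open>g\<close>, gives an isometry
  that fixes \<open>a\<close> and \<open>b\<close>; it fixes their midpoint, so \<open>g\<close> sends midpoint to midpoint.\<close>

lemma isometry_midpoint:
  fixes a b :: "'a::real_normed_vector"
  assumes g: "g \<in> isometries"
  shows "g ((1/2) *\<^sub>R (a + b)) = (1/2) *\<^sub>R (g a + g b)"
proof -
  define z where "z = (1/2) *\<^sub>R (a + b)"
  define \<psi> where "\<psi> x = (a + b) - x" for x
  define \<psi>' where "\<psi>' x = (g a + g b) - x" for x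
  obtain g' where g': "g' \<in> isometries" and inv_g: "\<And>x. g' (g x) = x" and inv_g': "\<And>x. g (g' x) = x"
    by (rule isometries_inverse[OF g]) blast
  define h where "h = \<psi> \<circ> (g' \<circ> (\<psi>' \<circ> g))"
  have "h \<in> isometries"
    unfolding h_def \<psi>_def \<psi>'_def
    by (intro isometries_comp g' point_reflection_isometry g)
  moreover have "h a = a" "h b = b"
    by (simp_all add: h_def \<psi>_def \<psi>'_def inv_g)
  ultimately have "h z = z" unfolding z_def by (rule isometry_fixes_midpoint)
  moreover have "a + b - z = z"
    unfolding z_def by (metis add_diff_cancel field_sum_of_halves scaleR_add_left scaleR_one)
  ultimately have "g' (\<psi>' (g z)) = z"
    by (simp add: h_def \<psi>_def) (metis add_diff_cancel_left' diff_add_cancel)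
  then have "g a + g b - g z = g z"
    by (metis inv_g' \<psi>'_def)
  then have "2 *\<^sub>R g z = g a + g b"
    by (simp add: scaleR_2 diff_eq_eq)
  then show ?thesis
    unfolding z_def[symmetric] by (metis scaleR_half_double scaleR_scaleR scaleR_2 scaleR_right_distrib)
qed

lemma additive_continuous_imp_linear:
  fixes f :: "'a::real_normed_vector \<Rightarrow> 'b::real_normed_vector"
  assumes add: "\<And>x y. f (x + y) = f x + f y" and cont: "continuous_on UNIV f"
  shows "linear f"
proof (rule linearI[OF add])
  fix r :: real and x
  have f0: "f 0 = 0" using add[of 0 0] by simp
  have neg: "f (- y) = - f y" for y using add[of y "- y"] f0 by (simp add: eq_neg_iff_add_eq_0 add.commute)
  have nat: "f (real n *\<^sub>R y) = real n *\<^sub>R f y" for n y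
    by (induction n) (simp_all add: f0 add scaleR_left_distrib)
  have int: "f (of_int k *\<^sub>R y) = of_int k *\<^sub>R f y" for k y
  proof (cases k rule: int_cases2)
    case (nonneg n)
    then show ?thesis by (simp add: nat)
  next
    case (nonpos n)
    then show ?thesis by (simp add: nat neg)
  qed
  define S where "S = {t. f (t *\<^sub>R x) = t *\<^sub>R f x}"
  have "closed S"
    unfolding S_def
    by (intro closed_Collect_eq continuous_intros continuous_on_compose2[OF cont]) auto
  moreover have "\<rat> \<subseteq> S"
  proof
    fix q :: real assume "q \<in> \<rat>"
    then obtain k m :: int where "m > 0" and q: "q = of_int k / of_int m"
      by (rule Rats_cases')
    then have m: "m \<noteq> 0" by simp
    have "of_int m *\<^sub>R f (q *\<^sub>R x) = f (of_int k *\<^sub>R x)"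
      using m by (simp add: q flip: int)
    also have "\<dots> = of_int m *\<^sub>R (q *\<^sub>R f x)"
      using m by (simp add: q int)
    finally show "q \<in> S" using m by (simp add: S_def del: scaleR_scaleR)
  qed
  ultimately have "closure \<rat> \<subseteq> S" by (rule closure_minimal[rotated])
  then show "f (r *\<^sub>R x) = r *\<^sub>R f x"
    using Rats_closure_real by (auto simp: S_def)
qed

text \<open>The Mazur--Ulam theorem. A map that preserves midpoints and \<open>0\<close> is additive.\<close>

theorem isometry_affine:
  fixes g :: "'a::real_normed_vector \<Rightarrow> 'a"
  assumes "g \<in> isometries"
  shows "linear (\<lambda>x. g x - g 0)"
proof (rule additive_continuous_imp_linear)
  define h where "h x = g x - g 0" for x
  have half: "h ((1/2) *\<^sub>R x) = (1/2) *\<^sub>R h x" for x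
  proof -
    have "g ((1/2) *\<^sub>R (x + 0)) = (1/2) *\<^sub>R (g x + g 0)" by (rule isometry_midpoint[OF assms])
    then have "h ((1/2) *\<^sub>R x) = (1/2) *\<^sub>R (g x + g 0) - g 0" by (simp add: h_def)
    also have "\<dots> = (1/2) *\<^sub>R h x"
      by (simp add: h_def algebra_simps flip: scaleR_add_left)
    finally show ?thesis .
  qed
  show "g (x + y) - g 0 = (g x - g 0) + (g y - g 0)" for x y
  proof -
    have "g ((1/2) *\<^sub>R (2 *\<^sub>R x + 2 *\<^sub>R y)) = (1/2) *\<^sub>R (g (2 *\<^sub>R x) + g (2 *\<^sub>R y))"
      by (rule isometry_midpoint[OF assms])
    also have "(1/2::real) *\<^sub>R (2 *\<^sub>R x + 2 *\<^sub>R y) = x + y"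
      by (simp add: scaleR_right_distrib)
    finally have "h (x + y) = (1/2) *\<^sub>R (g (2 *\<^sub>R x) + g (2 *\<^sub>R y)) - g 0"
      by (simp add: h_def)
    also have "\<dots> = (1/2) *\<^sub>R h (2 *\<^sub>R x) + (1/2) *\<^sub>R h (2 *\<^sub>R y)"
    proof -
      have "(1/2::real) *\<^sub>R g 0 + (1/2) *\<^sub>R g 0 = g 0"
        by (simp flip: scaleR_add_left)
      then show ?thesis
        unfolding h_def scaleR_right_distrib scaleR_diff_right by (metis (no_types, lifting) add_diff_eq diff_add_eq diff_diff_add)
    qed
    also have "\<dots> = h x + h y" by (simp flip: half)
    finally show ?thesis by (simp add: h_def)
  qed
  have "continuous_on UNIV g"
    unfolding continuous_on_iff using isometries_dist[OF assms] by metis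
  then show "continuous_on UNIV (\<lambda>x. g x - g 0)" by (intro continuous_intros)
qed

section \<open>Operators on affine functions\<close>

text \<open>The pair \<open>(f, r)\<close> stands for the affine function \<open>x \<mapsto> f x + r\<close>.\<close>

type_synonym 'a affine_function = "('a \<Rightarrow>\<^sub>L real) \<times> real"

definition value_at :: "'a::real_normed_vector affine_function \<Rightarrow> 'a \<Rightarrow> real"
  where "value_at F x = blinfun_apply (fst F) x + snd F"

lemma value_at_eqI:
  assumes "\<And>x. value_at F x = value_at F' x"
  shows "F = F'"
proof -
  have "snd F = snd F'" using assms[of 0] by (simp add: value_at_def)
  moreover have "fst F = fst F'"
    by (rule blinfun_eqI) (use assms \<open>snd F = snd F'\<close> in \<open>simp add: value_at_def\<close>)
  ultimately show ?thesis by (simp add: prod_eq_iff)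
qed

text \<open>A separate type, so that the operators can be made a Banach algebra. The product is composition in
  reverse order: \<open>g \<mapsto> (F \<mapsto> F \<circ> g)\<close> reverses the order of composition, and becomes a homomorphism in
  this way. Since there is always a non-zero affine function, \<open>norm 1 = 1\<close> holds even when \<open>X\<close> is
  trivial.\<close>

typedef (overloaded) 'a affine_operator =
  "UNIV :: ('a::real_normed_vector affine_function \<Rightarrow>\<^sub>L 'a affine_function) set"
  morphisms operator_blinfun Affine_Operator ..

setup_lifting type_definition_affine_operator

instantiation affine_operator :: (real_normed_vector) real_normed_algebra_1
begin

lift_definition zero_affine_operator :: "'a affine_operator" is 0 .
lift_definition one_affine_operator :: "'a affine_operator" is id_blinfun .
lift_definition plus_affine_operator :: "'a affine_operator \<Rightarrow> 'a affine_operator \<Rightarrow> 'a affine_operator"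
  is "(+)" .
lift_definition minus_affine_operator :: "'a affine_operator \<Rightarrow> 'a affine_operator \<Rightarrow> 'a affine_operator"
  is "(-)" .
lift_definition uminus_affine_operator :: "'a affine_operator \<Rightarrow> 'a affine_operator" is uminus .
lift_definition times_affine_operator :: "'a affine_operator \<Rightarrow> 'a affine_operator \<Rightarrow> 'a affine_operator"
  is "\<lambda>M N. N o\<^sub>L M" .
lift_definition scaleR_affine_operator :: "real \<Rightarrow> 'a affine_operator \<Rightarrow> 'a affine_operator"
  is scaleR .
lift_definition norm_affine_operator :: "'a affine_operator \<Rightarrow> real" is norm .

definition dist_affine_operator :: "'a affine_operator \<Rightarrow> 'a affine_operator \<Rightarrow> real"
  where "dist_affine_operator M N = norm (M - N)"

definition sgn_affine_operator :: "'a affine_operator \<Rightarrow> 'a affine_operator"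
  where "sgn_affine_operator M = scaleR (inverse (norm M)) M"

definition uniformity_affine_operator :: "('a affine_operator \<times> 'a affine_operator) filter"
  where "uniformity_affine_operator = (INF e\<in>{0 <..}. principal {(x, y). dist x y < e})"

definition open_affine_operator :: "'a affine_operator set \<Rightarrow> bool"
  where "open_affine_operator S = (\<forall>x\<in>S. \<forall>\<^sub>F (x', y) in uniformity. x' = x \<longrightarrow> y \<in> S)"

lemma norm_id_affine: "norm (id_blinfun :: 'a affine_function \<Rightarrow>\<^sub>L 'a affine_function) = 1"
proof (rule norm_blinfun_eqI[where x = "(0, 1)"])
  show "1 \<le> norm (blinfun_apply id_blinfun (0 :: 'a \<Rightarrow>\<^sub>L real, 1 :: real)) / norm (0 :: 'a \<Rightarrow>\<^sub>L real, 1 :: real)"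
    by (simp add: norm_prod_def)
qed auto

instance
proof
  fix L M N :: "'a affine_operator" and a b :: real
  show "L + M + N = L + (M + N)" by transfer (rule add.assoc)
  show "M + N = N + M" by transfer (rule add.commute)
  show "0 + M = M" by transfer simp
  show "- M + M = 0" by transfer simp
  show "M - N = M + - N" by transfer simp
  show "a *\<^sub>R (M + N) = a *\<^sub>R M + a *\<^sub>R N" by transfer (rule scaleR_add_right)
  show "(a + b) *\<^sub>R M = a *\<^sub>R M + b *\<^sub>R M" by transfer (rule scaleR_add_left)
  show "a *\<^sub>R b *\<^sub>R M = (a * b) *\<^sub>R M" by transfer simp
  show "1 *\<^sub>R M = M" by transfer simp
  show "L * M * N = L * (M * N)" by transfer (rule blinfun_eqI, simp)
  show "(L + M) * N = L * N + M * N"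
    by transfer (rule blinfun_eqI, simp add: blinfun.add_left blinfun.add_right)
  show "L * (M + N) = L * M + L * N"
    by transfer (rule blinfun_eqI, simp add: blinfun.add_left)
  show "a *\<^sub>R M * N = a *\<^sub>R (M * N)"
    by transfer (rule blinfun_eqI, simp add: blinfun.scaleR_left blinfun.scaleR_right)
  show "M * a *\<^sub>R N = a *\<^sub>R (M * N)"
    by transfer (rule blinfun_eqI, simp add: blinfun.scaleR_left)
  show "1 * M = M" by transfer (rule blinfun_eqI, simp)
  show "M * 1 = M" by transfer (rule blinfun_eqI, simp)
  show "(0 :: 'a affine_operator) \<noteq> 1"
    by transfer (metis norm_id_affine norm_zero zero_neq_one)
  show "dist M N = norm (M - N)" by (rule dist_affine_operator_def)
  show "sgn M = scaleR (inverse (norm M)) M" by (rule sgn_affine_operator_def)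
  show "(uniformity :: ('a affine_operator \<times> 'a affine_operator) filter)
      = (INF e\<in>{0 <..}. principal {(x, y). dist x y < e})"
    by (rule uniformity_affine_operator_def)
  show "open U = (\<forall>x\<in>U. \<forall>\<^sub>F (x', y) in uniformity. x' = x \<longrightarrow> y \<in> U)"
    for U :: "'a affine_operator set" by (rule open_affine_operator_def)
  show "norm M = 0 \<longleftrightarrow> M = 0" by transfer simp
  show "norm (M + N) \<le> norm M + norm N" by transfer (rule norm_triangle_ineq)
  show "norm (a *\<^sub>R M) = \<bar>a\<bar> * norm M" by transfer simp
  show "norm (M * N) \<le> norm M * norm N"
    by transfer (metis mult.commute norm_blinfun_compose)
  show "norm (1 :: 'a affine_operator) = 1" by transfer (rule norm_id_affine)
qed

end

lemma norm_operator_blinfun: "norm (operator_blinfun M) = norm M"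
  by transfer rule

lemma operator_blinfun_diff: "operator_blinfun (M - N) = operator_blinfun M - operator_blinfun N"
  by transfer rule

instance affine_operator :: (real_normed_vector) banach
proof
  fix X :: "nat \<Rightarrow> 'a affine_operator"
  assume "Cauchy X"
  then have "Cauchy (\<lambda>n. operator_blinfun (X n))"
    unfolding Cauchy_def dist_norm operator_blinfun_diff[symmetric] norm_operator_blinfun .
  then obtain L where L: "(\<lambda>n. operator_blinfun (X n)) \<longlonglongrightarrow> L"
    using Cauchy_convergent convergent_def by blast
  have "operator_blinfun (Affine_Operator L) = L" by (simp add: Affine_Operator_inverse)
  then have "norm (operator_blinfun (X n) - L) = norm (X n - Affine_Operator L)" for n
    by (metis norm_operator_blinfun operator_blinfun_diff)
  moreover have "(\<lambda>n. norm (operator_blinfun (X n) - L)) \<longlonglongrightarrow> 0"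
    using L by (intro tendsto_norm_zero LIM_zero)
  ultimately have "(\<lambda>n. norm (X n - Affine_Operator L)) \<longlonglongrightarrow> 0" by simp
  then have "X \<longlonglongrightarrow> Affine_Operator L"
    by (rule LIM_zero_cancel[OF tendsto_norm_zero_cancel])
  then show "convergent X" by (auto simp: convergent_def)
qed

text \<open>An operator is handled through the numbers \<open>(M F)(x)\<close>, which determine it.\<close>

definition act :: "'a::real_normed_vector affine_operator \<Rightarrow> 'a affine_function \<Rightarrow> 'a \<Rightarrow> real"
  where "act M F x = value_at (blinfun_apply (operator_blinfun M) F) x"

lemma affine_operator_eqI: "(\<And>F x. act M F x = act N F x) \<Longrightarrow> M = N"
  by (metis act_def blinfun_eqI operator_blinfun_inject value_at_eqI)

lemma act_one: "act 1 F x = value_at F x"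
  by (simp add: act_def one_affine_operator.rep_eq)

lemma act_mult: "act (M * N) F x = act N (blinfun_apply (operator_blinfun M) F) x"
  by (simp add: act_def times_affine_operator.rep_eq)

lemma act_Affine_Operator:
  "bounded_linear T \<Longrightarrow> act (Affine_Operator (Blinfun T)) F x = value_at (T F) x"
  by (simp add: act_def Affine_Operator_inverse bounded_linear_Blinfun_apply)

lemma bounded_linear_value_at: "bounded_linear (\<lambda>F. value_at F x)"
  unfolding value_at_def
  by (intro bounded_linear_add bounded_linear_compose[OF blinfun.bounded_linear_left] bounded_linear_fst bounded_linear_snd)

lemma bounded_linear_operator_blinfun: "bounded_linear operator_blinfun"
  by (rule bounded_linear_intro[where K = 1])
    (simp_all add: plus_affine_operator.rep_eq scaleR_affine_operator.rep_eq norm_operator_blinfun)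

lemma bounded_linear_act: "bounded_linear (\<lambda>M. act M F x)"
  unfolding act_def
  by (intro bounded_linear_compose[OF bounded_linear_value_at]
      bounded_linear_compose[OF blinfun.bounded_linear_left] bounded_linear_operator_blinfun)

lemmas linear_act = bounded_linear.linear[OF bounded_linear_act]

lemma continuous_on_value_at: "continuous_on S (value_at F)"
  unfolding value_at_def [abs_def] by (intro continuous_intros)

lemma finite_dimensional_linear_image:
  assumes "finite_dimensional V" "linear f"
  shows "finite_dimensional (f ` V)"
proof -
  obtain B where B: "finite B" "V \<subseteq> span B"
    using assms(1) unfolding finite_dimensional_def by blast
  have "f ` V \<subseteq> span (f ` B)"
    using B(2) linear_span_image[OF assms(2), of B] by blast
  with B(1) show ?thesis unfolding finite_dimensional_def by blast
qed

lemma finite_dimensional_affine_operator: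
  assumes "finite_dimensional (UNIV :: 'a::real_normed_vector set)"
  shows "finite_dimensional (UNIV :: 'a affine_operator set)"
proof -
  have "finite_dimensional (UNIV :: ('a affine_function \<Rightarrow>\<^sub>L 'a affine_function) set)"
    by (intro finite_dimensional_blinfun finite_dimensional_prod finite_dimensional_real assms)
  moreover have "linear (Affine_Operator :: _ \<Rightarrow> 'a affine_operator)"
    by (rule linearI) (simp_all add: plus_affine_operator.abs_eq scaleR_affine_operator.abs_eq)
  moreover have "range (Affine_Operator :: _ \<Rightarrow> 'a affine_operator) = UNIV"
    by (metis operator_blinfun_inverse surjI)
  ultimately show ?thesis
    using finite_dimensional_linear_image by metis
qed

section \<open>The isometry group as a closed group of operators\<close>

locale finite_basis =
  fixes B :: "'a::real_normed_vector set"
  assumes finite_B: "finite B" and independent_B: "independent B" and span_B: "span B = UNIV"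
begin

lemma finite_dim_space: "finite_dimensional (UNIV :: 'a set)"
  unfolding finite_dimensional_def using finite_B span_B by blast

lemmas expand = sum_coordinates[OF finite_B independent_B span_B]

definition coord :: "'a \<Rightarrow> 'a \<Rightarrow>\<^sub>L real"
  where "coord b = Blinfun (\<lambda>x. representation B x b)"

lemma coord_apply: "blinfun_apply (coord b) x = representation B x b"
  unfolding coord_def
  by (simp add: bounded_linear_Blinfun_apply bounded_linear_coordinate finite_B independent_B span_B)

definition const_operator :: "'a affine_operator"
  where "const_operator = Affine_Operator (Blinfun (\<lambda>F. (0, snd F)))"

definition shift_operator :: "'a \<Rightarrow> 'a affine_operator"
  where "shift_operator y = Affine_Operator (Blinfun (\<lambda>F. (0, blinfun_apply (fst F) y)))"

definition rank_one_operator :: "'a \<Rightarrow> 'a \<Rightarrow> 'a affine_operator"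
  where "rank_one_operator b y =
    Affine_Operator (Blinfun (\<lambda>F. (blinfun_apply (fst F) y *\<^sub>R coord b, 0)))"

lemma bounded_linear_apply_fst: "bounded_linear (\<lambda>F :: 'a affine_function. blinfun_apply (fst F) y)"
  by (intro bounded_linear_compose[OF blinfun.bounded_linear_left] bounded_linear_fst)

lemma act_const_operator: "act const_operator F x = snd F"
  unfolding const_operator_def
  by (subst act_Affine_Operator)
    (auto intro!: bounded_linear_Pair bounded_linear_snd bounded_linear_zero simp: value_at_def)

lemma act_shift_operator: "act (shift_operator y) F x = blinfun_apply (fst F) y"
  unfolding shift_operator_def
  by (subst act_Affine_Operator)
    (auto intro!: bounded_linear_Pair bounded_linear_apply_fst bounded_linear_zero simp: value_at_def)

lemma act_rank_one_operator:
  "act (rank_one_operator b y) F x = blinfun_apply (fst F) y * representation B x b"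
  unfolding rank_one_operator_def
  by (subst act_Affine_Operator)
    (auto intro!: bounded_linear_Pair bounded_linear_scaleR_const bounded_linear_apply_fst bounded_linear_zero
      simp: value_at_def blinfun.scaleR_left coord_apply)

lemma bounded_linear_shift_operator: "bounded_linear shift_operator"
  by (intro linear_imp_bounded_linear finite_dim_space linearI affine_operator_eqI)
    (simp_all add: linear_add[OF linear_act] linear_scale[OF linear_act] act_shift_operator
      blinfun.add_right blinfun.scaleR_right)

lemma bounded_linear_rank_one_operator: "bounded_linear (rank_one_operator b)"
  by (intro linear_imp_bounded_linear finite_dim_space linearI affine_operator_eqI)
    (simp_all add: linear_add[OF linear_act] linear_scale[OF linear_act] act_rank_one_operator
      blinfun.add_right blinfun.scaleR_right algebra_simps)

text \<open>For affine \<open>g\<close> this is the operator \<open>F \<mapsto> F \<circ> g\<close>, written out in the basis: then its continuous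
  dependence on the finitely many points \<open>g 0\<close> and \<open>g b\<close> is visible.\<close>

definition composition_operator :: "('a \<Rightarrow> 'a) \<Rightarrow> 'a affine_operator"
  where "composition_operator g =
    const_operator + shift_operator (g 0) + (\<Sum>b\<in>B. rank_one_operator b (g b - g 0))"

lemma act_composition_operator:
  assumes "g \<in> isometries"
  shows "act (composition_operator g) F x = value_at F (g x)"
proof -
  have lin: "linear (\<lambda>x. g x - g 0)" by (rule isometry_affine[OF assms])
  have "act (composition_operator g) F x = snd F + blinfun_apply (fst F) (g 0)
      + (\<Sum>b\<in>B. blinfun_apply (fst F) (g b - g 0) * representation B x b)"
    by (simp add: composition_operator_def linear_add[OF linear_act] linear_sum[OF linear_act]
        act_const_operator act_shift_operator act_rank_one_operator)
  also have "(\<Sum>b\<in>B. blinfun_apply (fst F) (g b - g 0) * representation B x b)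
      = blinfun_apply (fst F) (\<Sum>b\<in>B. representation B x b *\<^sub>R (g b - g 0))"
    by (simp add: blinfun.sum_right blinfun.scaleR_right mult.commute)
  also have "(\<Sum>b\<in>B. representation B x b *\<^sub>R (g b - g 0)) = g (\<Sum>b\<in>B. representation B x b *\<^sub>R b) - g 0"
    using linear_sum[OF lin, of "\<lambda>b. representation B x b *\<^sub>R b" B] linear_scale[OF lin] by simp
  finally show ?thesis
    by (simp add: expand value_at_def blinfun.diff_right)
qed

text \<open>The map of \<open>X\<close> whose coordinates are the images under \<open>M\<close> of the coordinate functions. It returns
  \<open>g\<close> for the composition operator of an isometry \<open>g\<close>, and for \<open>M\<close> in the Lie algebra it is
  the velocity field of the flow \<open>exp (t M)\<close>.\<close>

definition underlying_map :: "'a affine_operator \<Rightarrow> 'a \<Rightarrow> 'a"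
  where "underlying_map M x = (\<Sum>b\<in>B. act M (coord b, 0) x *\<^sub>R b)"

lemma bounded_linear_underlying_map: "bounded_linear (\<lambda>M. underlying_map M x)"
  unfolding underlying_map_def by (intro bounded_linear_sum bounded_linear_scaleR_const bounded_linear_act)

lemmas linear_underlying_map = bounded_linear.linear[OF bounded_linear_underlying_map]

lemma underlying_map_eqI:
  assumes "\<And>f. act M (f, 0) x = blinfun_apply f y"
  shows "underlying_map M x = y"
  by (simp add: underlying_map_def assms coord_apply expand)

lemma underlying_map_composition_operator: "g \<in> isometries \<Longrightarrow> underlying_map (composition_operator g) x = g x"
  by (rule underlying_map_eqI) (simp add: act_composition_operator value_at_def)

lemma act_mult_composition_operator:
  "g \<in> isometries \<Longrightarrow> act (M * composition_operator g) F x = act M F (g x)"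
  by (simp add: act_mult act_composition_operator) (simp add: act_def)

lemma underlying_map_mult_composition_operator:
  "g \<in> isometries \<Longrightarrow> underlying_map (M * composition_operator g) x = underlying_map M (g x)"
  by (simp add: underlying_map_def act_mult_composition_operator)

lemma composition_operator_id: "composition_operator id = 1"
  by (rule affine_operator_eqI) (simp add: act_composition_operator isometries_id act_one)

lemma composition_operator_comp:
  "g \<in> isometries \<Longrightarrow> h \<in> isometries \<Longrightarrow>
    composition_operator (g \<circ> h) = composition_operator g * composition_operator h"
  by (rule affine_operator_eqI)
    (simp add: act_composition_operator act_mult_composition_operator isometries_comp)

definition isometry_group :: "'a affine_operator set"
  where "isometry_group = composition_operator ` isometries"

lemma linear_injective_endomorphism_surj:
  fixes f :: "'a \<Rightarrow> 'a"
  assumes "linear f" "inj f"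
  shows "surj f"
proof -
  interpret finite_dimensional_vector_space_pair "scaleR :: real \<Rightarrow> 'a \<Rightarrow> 'a" B "scaleR :: real \<Rightarrow> 'a \<Rightarrow> 'a" B
    by unfold_locales
      (use finite_B independent_B span_B in \<open>simp_all add: dependent_raw_def span_raw_def\<close>)
  show ?thesis
    using linear_injective_imp_surjective[OF _ assms(2) refl] assms(1) unfolding linear_def by blast
qed

text \<open>A limit of composition operators is the composition operator of the pointwise limit \<open>h\<close> of the
  isometries. The limit is affine and preserves distances, hence onto by finite dimension.\<close>

lemma closed_isometry_group: "closed isometry_group"
  unfolding closed_sequential_limits
proof (intro allI impI, elim conjE)
  fix m :: "nat \<Rightarrow> 'a affine_operator" and l
  assume m: "\<forall>n. m n \<in> isometry_group" and l: "m \<longlonglongrightarrow> l"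
  then have "\<forall>n. \<exists>g. g \<in> isometries \<and> m n = composition_operator g"
    by (auto simp: isometry_group_def)
  then obtain g where g: "\<And>n. g n \<in> isometries" and m_eq: "\<And>n. m n = composition_operator (g n)"
    by metis
  define h where "h = underlying_map l"
  have lim: "(\<lambda>n. g n x) \<longlonglongrightarrow> h x" for x
    using bounded_linear.tendsto[OF bounded_linear_underlying_map l, of x]
    by (simp add: m_eq underlying_map_composition_operator g h_def)
  have dist: "dist (h x) (h y) = dist x y" for x y
    using tendsto_dist[OF lim[of x] lim[of y]] LIMSEQ_unique[OF _ tendsto_const]
    by (simp add: isometries_dist[OF g])
  have "linear (\<lambda>x. h x - h 0)"
  proof (rule linearI)
    note lin = isometry_affine[OF g]
    fix x y :: 'a and r :: real
    have "(\<lambda>n. (g n x - g n 0) + (g n y - g n 0)) \<longlonglongrightarrow> (h x - h 0) + (h y - h 0)"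
      by (intro tendsto_intros lim)
    moreover have "(\<lambda>n. (g n x - g n 0) + (g n y - g n 0)) \<longlonglongrightarrow> h (x + y) - h 0"
      unfolding linear_add[OF lin, symmetric] by (intro tendsto_intros lim)
    ultimately show "h (x + y) - h 0 = (h x - h 0) + (h y - h 0)"
      by (rule LIMSEQ_unique[symmetric])
    have "(\<lambda>n. r *\<^sub>R (g n x - g n 0)) \<longlonglongrightarrow> r *\<^sub>R (h x - h 0)"
      by (intro tendsto_intros lim)
    moreover have "(\<lambda>n. r *\<^sub>R (g n x - g n 0)) \<longlonglongrightarrow> h (r *\<^sub>R x) - h 0"
      unfolding linear_scale[OF lin, symmetric] by (intro tendsto_intros lim)
    ultimately show "h (r *\<^sub>R x) - h 0 = r *\<^sub>R (h x - h 0)"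
      by (rule LIMSEQ_unique[symmetric])
  qed
  moreover have "inj (\<lambda>x. h x - h 0)"
  proof (rule injI)
    fix x y assume "h x - h 0 = h y - h 0"
    then show "x = y" using dist[of x y] by simp
  qed
  ultimately have "surj (\<lambda>x. h x - h 0)" by (rule linear_injective_endomorphism_surj)
  have "surj h"
    unfolding surj_def
  proof
    fix y
    obtain x where "y - h 0 = h x - h 0"
      using \<open>surj (\<lambda>x. h x - h 0)\<close> unfolding surj_def by blast
    then have "y = h x" by simp
    then show "\<exists>x. y = h x" ..
  qed
  then have h: "h \<in> isometries" using dist by (rule isometriesI)
  have "l = composition_operator h"
  proof (rule affine_operator_eqI)
    fix F x
    have "(\<lambda>n. value_at F (g n x)) \<longlonglongrightarrow> act l F x"
      using bounded_linear.tendsto[OF bounded_linear_act l, of F x]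
      by (simp add: m_eq act_composition_operator g)
    moreover have "(\<lambda>n. value_at F (g n x)) \<longlonglongrightarrow> value_at F (h x)"
      by (rule continuous_on_tendsto_compose[OF continuous_on_value_at[of UNIV] lim]) auto
    ultimately have "act l F x = value_at F (h x)" by (rule LIMSEQ_unique)
    then show "act l F x = act (composition_operator h) F x"
      by (simp add: act_composition_operator h)
  qed
  with h show "l \<in> isometry_group" by (simp add: isometry_group_def)
qed

sublocale closed_group isometry_group
proof
  show "finite_dimensional (UNIV :: 'a affine_operator set)"
    by (rule finite_dimensional_affine_operator[OF finite_dim_space])
  show "closed isometry_group" by (rule closed_isometry_group)
  show "1 \<in> isometry_group"
    unfolding isometry_group_def using isometries_id composition_operator_id by force
  show "M * N \<in> isometry_group" if "M \<in> isometry_group" "N \<in> isometry_group" for M N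
    using that unfolding isometry_group_def
    by (auto intro!: imageI isometries_comp simp flip: composition_operator_comp)
  show "\<exists>N\<in>isometry_group. M * N = 1 \<and> N * M = 1" if M: "M \<in> isometry_group" for M
  proof -
    obtain g where g: "g \<in> isometries" and M: "M = composition_operator g"
      using M by (auto simp: isometry_group_def)
    obtain k where k: "k \<in> isometries" "\<And>x. k (g x) = x" "\<And>x. g (k x) = x"
      using isometries_inverse[OF g] by blast
    then have "g \<circ> k = id" "k \<circ> g = id" by auto
    then have "M * composition_operator k = 1" "composition_operator k * M = 1"
      using composition_operator_comp[OF g k(1)] composition_operator_comp[OF k(1) g]
      by (simp_all add: M composition_operator_id)
    then show ?thesis using k(1) unfolding isometry_group_def by blast
  qed
qed

lemma homeomorphism_isometries: "homeomorphism isometries isometry_group composition_operator underlying_map"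
  unfolding homeomorphism_def
proof (intro conjI ballI)
  show "composition_operator ` isometries = isometry_group" by (simp add: isometry_group_def)
  show fc: "underlying_map (composition_operator g) = g" if "g \<in> isometries" for g
    using underlying_map_composition_operator[OF that] by blast
  show "composition_operator (underlying_map M) = M" if "M \<in> isometry_group" for M
    using that fc by (auto simp: isometry_group_def)
  show "underlying_map ` isometry_group = isometries"
    unfolding isometry_group_def image_image by (simp add: fc)
  show "continuous_on isometries composition_operator"
    unfolding composition_operator_def
    by (intro continuous_intros bounded_linear.continuous_on[OF bounded_linear_shift_operator]
        bounded_linear.continuous_on[OF bounded_linear_rank_one_operator])
  show "continuous_on isometry_group underlying_map"
    by (rule continuous_on_coordinatewise_then_product)
      (rule linear_continuous_on[OF bounded_linear_underlying_map])
qed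

lemma manifold_dim_isometries:
  "manifold_dim (top_of_set (isometries :: ('a \<Rightarrow> 'a) set)) = dim lie_algebra"
proof (rule manifold_dim_eq)
  show "locally_Euclidean (dim lie_algebra) (top_of_set (isometries :: ('a \<Rightarrow> 'a) set))"
    by (rule locally_Euclidean_homeomorphic[OF locally_Euclidean_group
          homeomorphism_imp_homeomorphic_map[OF homeomorphism_isometries]])
  show "topspace (top_of_set (isometries :: ('a \<Rightarrow> 'a) set)) \<noteq> {}"
    using isometries_id by auto
qed

end

section \<open>Trivial motions and tangent spaces\<close>

lemma mem_placement_orbit: "u \<in> placement_orbit q \<longleftrightarrow> (\<exists>g\<in>isometries. u = g \<circ> q)"
  by (auto simp: placement_orbit_def orbit_map_def)

lemma placement_orbit_comp:
  fixes p :: "'s \<Rightarrow> 'a::metric_space"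
  assumes g: "g \<in> isometries"
  shows "placement_orbit (g \<circ> p) = placement_orbit p"
proof -
  obtain k where k: "k \<in> isometries" "\<And>x. k (g x) = x"
    by (rule isometries_inverse[OF g]) blast
  have "h \<circ> (g \<circ> p) = (h \<circ> g) \<circ> p" and "h \<circ> p = (h \<circ> k) \<circ> (g \<circ> p)" for h :: "'a \<Rightarrow> 'a"
    using k(2) by (auto simp: fun_eq_iff)
  then show ?thesis
    unfolding set_eq_iff mem_placement_orbit by (metis g k(1) isometries_comp)
qed

text \<open>So curves in the isometry group are curves in the orbit of a placement, namely of the identity.\<close>

lemma placement_orbit_id: "placement_orbit id = isometries"
  by (auto simp: placement_orbit_def orbit_map_def)

lemma smooth_curve_through_imp_trivial_motion:
  assumes "smooth_curve_through (placement_orbit q) q u \<gamma>"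
  shows "u \<in> trivial_motions q"
proof -
  obtain \<delta> where \<delta>: "\<delta> > 0" "smooth_curve \<delta> \<gamma>" "\<gamma> ` {-\<delta><..<\<delta>} \<subseteq> placement_orbit q"
    and \<gamma>: "\<gamma> 0 = q" "has_velocity \<gamma> u 0"
    using assms unfolding smooth_curve_through_def by blast
  obtain D where D: "D 0 = \<gamma>" "\<And>n t. t \<in> {-\<delta><..<\<delta>} \<Longrightarrow> has_velocity (D n) (D (Suc n) t) t"
    using \<delta>(2) unfolding smooth_curve_def by blast
  have "continuous_on {-\<delta><..<\<delta>} (\<lambda>t. \<gamma> t v)" for v
  proof (rule continuous_at_imp_continuous_on, rule ballI)
    fix t assume "t \<in> {-\<delta><..<\<delta>}"
    from D(2)[OF this, of 0] show "isCont (\<lambda>t. \<gamma> t v) t"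
      unfolding has_velocity_def D(1) using has_vector_derivative_continuous by blast
  qed
  then have "trivial_finite_motion q \<delta> (\<lambda>v t. \<gamma> t v)"
    using \<delta> \<gamma>(1) unfolding trivial_finite_motion_def by auto
  moreover have "\<forall>v. ((\<lambda>t. \<gamma> t v) has_vector_derivative u v) (at 0)"
    using \<gamma>(2) by (simp add: has_velocity_def)
  ultimately show ?thesis unfolding trivial_motions_def by fast
qed

text \<open>The velocity of \<open>\<gamma> t \<circ> p\<close> is \<open>u \<circ> p\<close> for every curve \<open>\<gamma>\<close> with velocity \<open>u\<close>.\<close>

lemma differential_orbit_map:
  assumes "u \<in> tangent_space isometries g"
  shows "differential isometries (orbit_map p) g u = u \<circ> p"
  unfolding differential_def
proof (rule the_equality)
  have velocity: "has_velocity (orbit_map p \<circ> \<gamma>) (u \<circ> p) 0" if "smooth_curve_through isometries g u \<gamma>" for \<gamma>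
    using that unfolding smooth_curve_through_def has_velocity_def orbit_map_def by simp
  then show "\<exists>\<gamma>. smooth_curve_through isometries g u \<gamma> \<and> has_velocity (orbit_map p \<circ> \<gamma>) (u \<circ> p) 0"
    using assms unfolding tangent_space_def by blast
  fix w assume "\<exists>\<gamma>. smooth_curve_through isometries g u \<gamma> \<and> has_velocity (orbit_map p \<circ> \<gamma>) w 0"
  then obtain \<gamma> where "has_velocity (orbit_map p \<circ> \<gamma>) w 0" "has_velocity (orbit_map p \<circ> \<gamma>) (u \<circ> p) 0"
    using velocity by blast
  then show "w = u \<circ> p"
    unfolding has_velocity_def using vector_derivative_unique_at by blast
qed

lemma constant_is_trivial_motion:
  fixes p :: "'s \<Rightarrow> 'a::real_normed_vector"
  shows "(\<lambda>v. c) \<in> trivial_motions p"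
proof -
  have "(\<lambda>x. x + t *\<^sub>R c) \<in> isometries" for t
  proof (rule isometriesI)
    show "surj (\<lambda>x. x + t *\<^sub>R c)" by (rule surjI[of _ "\<lambda>x. x - t *\<^sub>R c"]) simp
  qed simp
  then have "(\<lambda>v. p v + t *\<^sub>R c) \<in> placement_orbit p" for t
    unfolding mem_placement_orbit by (intro bexI[of _ "\<lambda>x. x + t *\<^sub>R c"]) auto
  then have "trivial_finite_motion p 1 (\<lambda>v t. p v + t *\<^sub>R c)"
    unfolding trivial_finite_motion_def by (auto intro!: continuous_intros)
  moreover have "((\<lambda>t. p v + t *\<^sub>R c) has_vector_derivative c) (at 0)" for v
    by (auto intro!: derivative_eq_intros)
  ultimately show ?thesis unfolding trivial_motions_def by blast
qed

context finite_basis
begin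

lemma underlying_map_isometry: "M \<in> isometry_group \<Longrightarrow> underlying_map M \<in> isometries"
  using homeomorphism_isometries unfolding homeomorphism_def by blast

lemma exp_scaleR_mem: "A \<in> lie_algebra \<Longrightarrow> exp (t *\<^sub>R A) \<in> isometry_group"
  by (simp add: lie_algebra_def)

text \<open>Elements of the Lie algebra annihilate constant functions and are given on the others by their
  velocity field. This is the derivative of the identity \<open>(M F)(x) = f (g x) + r\<close>, valid for
  \<open>F = (f, r)\<close> and \<open>M = exp (t A)\<close>, where \<open>g\<close> is the isometry underlying \<open>M\<close>.\<close>

lemma act_lie_algebra:
  assumes "A \<in> lie_algebra"
  shows "act A F x = blinfun_apply (fst F) (underlying_map A x)"
proof -
  define \<Phi> where "\<Phi> M = act M F x - blinfun_apply (fst F) (underlying_map M x)" for M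
  have lin: "bounded_linear \<Phi>"
    unfolding \<Phi>_def
    by (intro bounded_linear_sub bounded_linear_act bounded_linear_compose[OF blinfun.bounded_linear_right]
        bounded_linear_underlying_map)
  have "\<Phi> M = snd F" if "M \<in> isometry_group" for M
    using that unfolding isometry_group_def \<Phi>_def
    by (auto simp: act_composition_operator underlying_map_composition_operator value_at_def)
  then have "(\<lambda>t. \<Phi> (exp (t *\<^sub>R A))) = (\<lambda>t. snd F)"
    using exp_scaleR_mem[OF assms] by blast
  then have "((\<lambda>t. \<Phi> (exp (t *\<^sub>R A))) has_vector_derivative 0) (at 0)"
    by simp
  moreover have "((\<lambda>t. \<Phi> (exp (t *\<^sub>R A))) has_vector_derivative \<Phi> A) (at 0)"
    by (rule bounded_linear.has_vector_derivative[OF lin exp_has_vector_derivative_0])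
  ultimately have "\<Phi> A = 0" using vector_derivative_unique_at by blast
  then show ?thesis by (simp add: \<Phi>_def)
qed

text \<open>The differential at the identity of the orbit map of \<open>q\<close>.\<close>

definition motion :: "('s \<Rightarrow> 'a) \<Rightarrow> 'a affine_operator \<Rightarrow> 's \<Rightarrow> 'a"
  where "motion q A = (\<lambda>v. underlying_map A (q v))"

lemma linear_motion: "linear (motion q)"
  by (rule linearI)
    (simp_all add: motion_def fun_eq_iff scaleR_fun_def linear_add[OF linear_underlying_map] linear_scale[OF linear_underlying_map])

text \<open>Choose isometries \<open>g n\<close> realizing the motion at times \<open>t n \<rightarrow> 0\<close>. They are bounded, since they
  move some point of \<open>q\<close> along a convergent sequence. The functionals \<open>M \<mapsto> (M F)(q v)\<close>, for all
  \<open>F\<close> and \<open>v\<close>, describe the orbit of \<open>q\<close>: their common kernel is a left ideal because \<open>(N M) F = M (N F)\<close>.\<close>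

lemma trivial_motion_imp_motion:
  fixes q :: "'s \<Rightarrow> 'a"
  assumes "u \<in> trivial_motions q"
  obtains A where "A \<in> lie_algebra" "u = motion q A"
proof -
  obtain \<delta> \<alpha> where \<alpha>: "trivial_finite_motion q \<delta> \<alpha>" "\<And>v. (\<alpha> v has_vector_derivative u v) (at 0)"
    using assms unfolding trivial_motions_def by blast
  then have \<delta>: "\<delta> > 0" and \<alpha>0: "\<And>v. \<alpha> v 0 = q v"
    and orbit: "\<And>t. t \<in> {-\<delta><..<\<delta>} \<Longrightarrow> (\<lambda>v. \<alpha> v t) \<in> placement_orbit q"
    unfolding trivial_finite_motion_def by auto
  \<comment> \<open>\<open>n + 2\<close>, so that already \<open>t 0 < \<delta>\<close>\<close>
  define t where "t n = \<delta> / real (Suc (Suc n))" for n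
  have t: "t n > 0" "t n < \<delta>" for n
    using \<delta> divide_strict_left_mono[of 1 "real (Suc (Suc n))" \<delta>] by (auto simp: t_def)
  have "(\<lambda>n. \<delta> * (1 / real (Suc (Suc n)))) \<longlonglongrightarrow> 0"
    by (rule tendsto_mult_right_zero[OF LIMSEQ_Suc[OF LIMSEQ_Suc[OF lim_1_over_n]]])
  then have t0: "t \<longlonglongrightarrow> 0" by (simp add: t_def [abs_def])
  have "\<exists>g\<in>isometries. (\<lambda>v. \<alpha> v (t n)) = g \<circ> q" for n
  proof -
    have "t n \<in> {-\<delta><..<\<delta>}" using t(1)[of n] t(2)[of n] \<delta> by simp
    from orbit[OF this] show ?thesis unfolding mem_placement_orbit .
  qed
  then obtain g where g: "\<And>n. g n \<in> isometries" and gq: "\<And>n. (\<lambda>v. \<alpha> v (t n)) = g n \<circ> q"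
    by metis
  have \<alpha>_eq: "\<alpha> v (t n) = g n (q v)" for v n using gq[of n] by (simp add: fun_eq_iff)
  \<comment> \<open>any point of the placement will do\<close>
  define v0 :: 's where "v0 = undefined"
  have "isCont (\<alpha> v0) 0" by (rule has_vector_derivative_continuous[OF \<alpha>(2)])
  then have "(\<lambda>n. \<alpha> v0 (t n)) \<longlonglongrightarrow> \<alpha> v0 0" using t0 by (rule isCont_tendsto_compose)
  then have "Bseq (\<lambda>n. \<alpha> v0 (t n))" by (intro convergent_imp_Bseq convergentI)
  then obtain c where c: "\<And>n. norm (\<alpha> v0 (t n)) \<le> c" by (auto simp: Bseq_def)
  have g_bound: "norm (g n x) \<le> c + norm (x - q v0)" for n x
    using isometries_dist[OF g, of n x "q v0"] c[of n] norm_triangle_ineq[of "g n (q v0)" "g n x - g n (q v0)"]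
    by (simp add: dist_norm \<alpha>_eq)
  define C where "C x = c + norm (x - q v0)" for x
  have "norm (composition_operator (g n)) \<le> norm const_operator + onorm shift_operator * C 0
      + (\<Sum>b\<in>B. onorm (rank_one_operator b) * (C b + C 0))" for n
  proof -
    have s: "norm (shift_operator (g n 0)) \<le> onorm shift_operator * C 0"
      using onorm[OF bounded_linear_shift_operator, of "g n 0"]
        mult_left_mono[OF g_bound[of n 0] onorm_pos_le[OF bounded_linear_shift_operator]]
      by (simp add: C_def)
    have r: "norm (rank_one_operator b (g n b - g n 0)) \<le> onorm (rank_one_operator b) * (C b + C 0)" for b
    proof -
      have "norm (g n b - g n 0) \<le> C b + C 0"
        using norm_triangle_ineq4[of "g n b" "g n 0"] g_bound[of n b] g_bound[of n 0] by (simp add: C_def)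
      then show ?thesis
        using onorm[OF bounded_linear_rank_one_operator, of b "g n b - g n 0"]
          mult_left_mono[OF _ onorm_pos_le[OF bounded_linear_rank_one_operator]] by (meson order_trans)
    qed
    show ?thesis
      unfolding composition_operator_def
      by (intro norm_triangle_le add_mono sum_norm_le order_refl s r)
  qed
  then obtain K where K: "\<And>n. norm (composition_operator (g n)) \<le> K" by blast
  define \<Lambda> where "\<Lambda> = (\<lambda>(v :: 's, F) M. act M F (q v))"
  define U where "U = (\<lambda>(v :: 's, F :: 'a affine_function). blinfun_apply (fst F) (u v))"
  obtain A where A: "A \<in> lie_algebra" "\<And>i. \<Lambda> i A = U i"
  proof (rule orbit_velocity_in_lie_algebra[of \<Lambda> "\<lambda>n. composition_operator (g n)" K t U])
    show "bounded_linear (\<Lambda> i)" for i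
      by (cases i) (simp add: \<Lambda>_def bounded_linear_act)
    show "\<Lambda> i (n * m) = 0" if "\<And>j. \<Lambda> j m = 0" for i n m
    proof -
      obtain v F where Pair: "i = (v, F)" by (cases i)
      show ?thesis
        using Pair that[of "(v, blinfun_apply (operator_blinfun n) F)"] by (simp add: \<Lambda>_def act_mult)
    qed
    show "composition_operator (g n) \<in> isometry_group" for n
      using g by (simp add: isometry_group_def)
    show "(\<lambda>n. (\<Lambda> i (composition_operator (g n)) - \<Lambda> i 1) / t n) \<longlonglongrightarrow> U i" for i
    proof -
      obtain v F where Pair: "i = (v, F)" by (cases i)
      have "(\<lambda>n. (\<alpha> v (t n) - \<alpha> v 0) /\<^sub>R t n) \<longlonglongrightarrow> u v"
        by (rule has_vector_derivative_imp_sequence[OF \<alpha>(2) t0]) (use t(1) in \<open>simp add: less_imp_neq[symmetric]\<close>)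
      then have "(\<lambda>n. blinfun_apply (fst F) ((\<alpha> v (t n) - \<alpha> v 0) /\<^sub>R t n)) \<longlonglongrightarrow> blinfun_apply (fst F) (u v)"
        by (intro tendsto_intros)
      then show ?thesis
        by (simp add: Pair \<Lambda>_def U_def act_composition_operator g act_one \<alpha>_eq \<alpha>0 value_at_def
            blinfun.diff_right blinfun.scaleR_right divide_inverse_commute)
    qed
  qed (use t t0 K in auto)
  have "u = motion q A"
  proof
    fix v
    have "underlying_map A (q v) = u v"
      by (rule underlying_map_eqI) (use A(2)[of "(v, _)"] in \<open>simp add: \<Lambda>_def U_def\<close>)
    then show "u v = motion q A v" by (simp add: motion_def)
  qed
  with A(1) show ?thesis by (rule that)
qed

text \<open>The \<open>n\<close>-th derivative of \<open>exp (t A)\<close> is \<open>A ^ n * exp (t A)\<close>.\<close>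

lemma flow_smooth_curve_through:
  assumes A: "A \<in> lie_algebra"
  shows "smooth_curve_through (placement_orbit q) q (motion q A) (\<lambda>t v. underlying_map (exp (t *\<^sub>R A)) (q v))"
proof -
  define D where "D n t v = underlying_map (A ^ n * exp (t *\<^sub>R A)) (q v)" for n t v
  have D: "has_velocity (D n) (D (Suc n) t) t" for n t
    unfolding has_velocity_def
  proof
    fix v
    have "((\<lambda>t. A ^ n * exp (t *\<^sub>R A)) has_vector_derivative A ^ n * (A * exp (t *\<^sub>R A))) (at t)"
      by (rule bounded_linear.has_vector_derivative[OF bounded_linear_mult_right
            exp_scaleR_has_vector_derivative_left])
    from bounded_linear.has_vector_derivative[OF bounded_linear_underlying_map this, of "q v"]
    show "((\<lambda>s. D n s v) has_vector_derivative D (Suc n) t v) (at t)"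
      by (simp add: D_def power_Suc2 mult.assoc del: power_Suc)
  qed
  have D0: "D 0 = (\<lambda>t v. underlying_map (exp (t *\<^sub>R A)) (q v))" by (simp add: D_def fun_eq_iff)
  have "smooth_curve 1 (D 0)" unfolding smooth_curve_def using D by blast
  moreover have "D 0 t \<in> placement_orbit q" for t
    unfolding mem_placement_orbit D0
    by (rule bexI[OF _ underlying_map_isometry[OF exp_scaleR_mem[OF A, of t]]]) auto
  moreover have "D 0 0 = q"
    using underlying_map_composition_operator[OF isometries_id] by (simp add: D0 composition_operator_id)
  moreover have "D 1 0 = motion q A"
    by (simp add: D_def motion_def fun_eq_iff)
  then have "has_velocity (D 0) (motion q A) 0" using D[of 0 0] by simp
  ultimately show ?thesis
    unfolding smooth_curve_through_def D0[symmetric] by (intro conjI exI[of _ 1]) auto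
qed

lemma trivial_motions_eq: "trivial_motions q = motion q ` lie_algebra"
proof
  show "trivial_motions q \<subseteq> motion q ` lie_algebra"
    using trivial_motion_imp_motion by blast
  show "motion q ` lie_algebra \<subseteq> trivial_motions q"
    using smooth_curve_through_imp_trivial_motion flow_smooth_curve_through by blast
qed

lemma tangent_space_orbit: "tangent_space (placement_orbit q) q = motion q ` lie_algebra"
proof
  show "tangent_space (placement_orbit q) q \<subseteq> motion q ` lie_algebra"
    unfolding tangent_space_def trivial_motions_eq[symmetric]
    using smooth_curve_through_imp_trivial_motion by blast
  show "motion q ` lie_algebra \<subseteq> tangent_space (placement_orbit q) q"
    unfolding tangent_space_def using flow_smooth_curve_through by blast
qed

lemma tangent_space_isometries:
  assumes "g \<in> isometries"
  shows "tangent_space isometries g = motion g ` lie_algebra"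
proof -
  have "placement_orbit g = isometries"
    using placement_orbit_comp[OF assms, of id] unfolding placement_orbit_id by simp
  then show ?thesis using tangent_space_orbit[of g] by simp
qed

lemma motion_eq_0_iff_of_isometry:
  assumes g: "g \<in> isometries" and A: "A \<in> lie_algebra"
  shows "motion g A = 0 \<longleftrightarrow> A = 0"
proof
  assume 0: "motion g A = 0"
  obtain k where k: "\<And>x. g (k x) = x" by (rule isometries_inverse[OF g]) blast
  have "underlying_map A x = 0" for x
    using fun_cong[OF 0, of "k x"] by (simp add: motion_def k)
  then show "A = 0"
    by (intro affine_operator_eqI) (simp add: act_lie_algebra[OF A] linear_0[OF linear_act])
qed (simp add: linear_0[OF linear_motion])

lemma conjugate_in_lie_algebra:
  assumes M: "M \<in> isometry_group" "N \<in> isometry_group" "M * N = 1" and A: "A \<in> lie_algebra"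
  shows "M * A * N \<in> lie_algebra"
proof (rule velocity_in_lie_algebra)
  show "((\<lambda>t. M * exp (t *\<^sub>R A) * N) has_vector_derivative M * A * N) (at 0)"
    by (intro bounded_linear.has_vector_derivative[OF bounded_linear_mult_left]
        bounded_linear.has_vector_derivative[OF bounded_linear_mult_right] exp_has_vector_derivative_0)
  show "M * exp (t *\<^sub>R A) * N \<in> isometry_group" for t
    by (intro mult_mem M exp_scaleR_mem A)
qed (simp add: M)

text \<open>If \<open>A\<close> generates the zero motion of \<open>g \<circ> p\<close>, then its conjugate by the inverse of \<open>g\<close> generates the
  zero motion of \<open>p\<close>.\<close>

lemma motion_injective_isometry_image:
  assumes inj: "\<And>A. A \<in> lie_algebra \<Longrightarrow> motion p A = 0 \<Longrightarrow> A = 0"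
    and g: "g \<in> isometries" and A: "A \<in> lie_algebra" "motion (g \<circ> p) A = 0"
  shows "A = 0"
proof -
  obtain k where k: "k \<in> isometries" "\<And>x. k (g x) = x" "\<And>x. g (k x) = x"
    by (rule isometries_inverse[OF g]) blast
  let ?g = "composition_operator g" and ?k = "composition_operator k"
  have gk: "?k * ?g = 1" "?g * ?k = 1"
    using composition_operator_comp[OF k(1) g] composition_operator_comp[OF g k(1)] k(2,3)
    by (simp_all add: o_def composition_operator_id[unfolded id_def])
  have "?k * A * ?g \<in> lie_algebra"
    by (rule conjugate_in_lie_algebra) (use g k gk A in \<open>auto simp: isometry_group_def\<close>)
  moreover have "motion p (?k * A * ?g) = 0"
  proof
    fix v
    have 0: "underlying_map A (g (p v)) = 0" using fun_cong[OF A(2), of v] by (simp add: motion_def)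
    have "motion p (?k * A * ?g) v = underlying_map (?k * A) (g (p v))"
      by (simp add: motion_def underlying_map_mult_composition_operator g)
    also have "\<dots> = 0"
      by (rule underlying_map_eqI) (simp add: act_mult act_lie_algebra[OF A(1)] 0)
    finally show "motion p (?k * A * ?g) v = 0 v" by simp
  qed
  ultimately have "?k * A * ?g = 0" by (rule inj)
  then have "?g * (?k * A * ?g) * ?k = 0" by simp
  moreover have "?g * (?k * A * ?g) * ?k = (?g * ?k) * A * (?g * ?k)" by (simp only: mult.assoc)
  ultimately show ?thesis by (simp add: gk)
qed

text \<open>At \<open>g\<close>, both tangent spaces are images of the Lie algebra, under \<open>motion g\<close> (injective) and
  \<open>motion (g \<circ> p)\<close>, and the differential of the orbit map carries the first to the second.\<close>

lemma full_iff_motion_injective: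
  "full p \<longleftrightarrow> (\<forall>A\<in>lie_algebra. motion p A = 0 \<longrightarrow> A = 0)"
proof -
  have inj_iff: "inj_on (motion q) lie_algebra \<longleftrightarrow> (\<forall>A\<in>lie_algebra. motion q A = 0 \<longrightarrow> A = 0)" for q :: "'t \<Rightarrow> 'a"
    using linear_injective_on_subspace_0[OF linear_motion subspace_lie_algebra] by blast
  have bij_iff: "bij_betw (differential isometries (orbit_map p) g) (tangent_space isometries g)
      (tangent_space (placement_orbit p) (orbit_map p g))
    \<longleftrightarrow> inj_on (motion (g \<circ> p)) lie_algebra" if g: "g \<in> isometries" for g
  proof -
    have orbit: "tangent_space (placement_orbit p) (orbit_map p g) = motion (g \<circ> p) ` lie_algebra"
      using tangent_space_orbit[of "g \<circ> p"] placement_orbit_comp[OF g, of p] by (simp add: orbit_map_def)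
    have diff: "differential isometries (orbit_map p) g (motion g A) = motion (g \<circ> p) A"
      if "A \<in> lie_algebra" for A
      using differential_orbit_map[of "motion g A" g p] tangent_space_isometries[OF g] that
      by (auto simp: motion_def)
    have inj: "inj_on (motion g) lie_algebra"
      unfolding inj_iff using motion_eq_0_iff_of_isometry[OF g] by blast
    have image: "differential isometries (orbit_map p) g ` motion g ` lie_algebra = motion (g \<circ> p) ` lie_algebra"
      unfolding image_image using diff by (rule image_cong[OF refl])
    have "inj_on (differential isometries (orbit_map p) g) (motion g ` lie_algebra)
        \<longleftrightarrow> inj_on (differential isometries (orbit_map p) g \<circ> motion g) lie_algebra"
      using inj comp_inj_on inj_on_imageI by blast
    also have "\<dots> \<longleftrightarrow> inj_on (motion (g \<circ> p)) lie_algebra"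
      by (rule inj_on_cong) (simp add: diff)
    finally show ?thesis
      unfolding bij_betw_def orbit tangent_space_isometries[OF g] using image by blast
  qed
  have "full p \<longleftrightarrow> (\<forall>g\<in>isometries. inj_on (motion (g \<circ> p)) lie_algebra)"
    unfolding full_def using bij_iff by blast
  also have "\<dots> \<longleftrightarrow> (\<forall>A\<in>lie_algebra. motion p A = 0 \<longrightarrow> A = 0)"
    unfolding inj_iff using motion_injective_isometry_image[of p] isometries_id by (metis id_comp)
  finally show ?thesis .
qed

end

section \<open>Dimension count\<close>

lemma finite_basis_of_subspace:
  assumes "finite_dimensional (V :: 'e::real_vector set)"
  obtains B where "B \<subseteq> V" "finite B" "independent B" "V \<subseteq> span B" "card B = dim V"
proof -
  obtain B where B: "B \<subseteq> V" "independent B" "V \<subseteq> span B" "card B = dim V"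
    by (rule basis_exists)
  obtain C where "finite C" "V \<subseteq> span C"
    using assms unfolding finite_dimensional_def by blast
  then have "finite B" using independent_span_bound[of C B] B by blast
  with B that show ?thesis by blast
qed

lemma dim_mono_finite_dimensional:
  assumes "finite_dimensional V" "S \<subseteq> V"
  shows "dim S \<le> dim V"
proof -
  obtain B where "finite B" "V \<subseteq> span B" "card B = dim V"
    using finite_basis_of_subspace[OF assms(1)] by metis
  with assms(2) dim_le_card[of S B] show ?thesis by simp
qed

text \<open>A non-zero kernel vector \<open>x\<close> extends to a basis of \<open>V\<close>, and the image is spanned by the images of the other
  basis vectors.\<close>

lemma dim_linear_image:
  fixes f :: "'e::real_vector \<Rightarrow> 'f::real_vector"
  assumes V: "subspace V" "finite_dimensional V" and f: "linear f"
  shows "dim (f ` V) \<le> dim V"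
    and "dim (f ` V) = dim V \<longleftrightarrow> (\<forall>x\<in>V. f x = 0 \<longrightarrow> x = 0)"
proof -
  obtain B where B: "B \<subseteq> V" "finite B" "independent B" "V \<subseteq> span B" "card B = dim V"
    by (rule finite_basis_of_subspace[OF V(2)])
  have span: "span B = V" using B span_minimal[OF B(1) V(1)] by blast
  have image: "f ` V = span (f ` B)" using linear_span_image[OF f, of B] span by simp
  have "dim (f ` V) \<le> card (f ` B)" using image B(2) by (intro dim_le_card) auto
  then show le: "dim (f ` V) \<le> dim V" using card_image_le[OF B(2), of f] B(5) by simp
  show "dim (f ` V) = dim V \<longleftrightarrow> (\<forall>x\<in>V. f x = 0 \<longrightarrow> x = 0)"
  proof
    assume "\<forall>x\<in>V. f x = 0 \<longrightarrow> x = 0"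
    then have inj: "inj_on f (span B)"
      unfolding span using linear_injective_on_subspace_0[OF f V(1)] by blast
    then have "independent (f ` B)" by (rule linear_independent_injective_image[OF f B(3)])
    moreover have "card (f ` B) = card B"
      by (rule card_image) (rule inj_on_subset[OF inj span_superset])
    ultimately show "dim (f ` V) = dim V"
      unfolding image dim_span using dim_eq_card_independent B(5) by metis
  next
    assume eq: "dim (f ` V) = dim V"
    show "\<forall>x\<in>V. f x = 0 \<longrightarrow> x = 0"
    proof (intro ballI impI, rule ccontr)
      fix x assume x: "x \<in> V" "f x = 0" "x \<noteq> 0"
      obtain C where C: "{x} \<subseteq> C" "C \<subseteq> V" "independent C" "V \<subseteq> span C"
        using maximal_independent_subset_extend[of "{x}" V] x by (auto simp: independent_insert)
      have finC: "finite C" using independent_span_bound[OF B(2) C(3)] C(2) B(4) by blast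
      have "card C = dim V" using basis_card_eq_dim[OF C(2,4,3)] .
      have "f ` V \<subseteq> span (f ` C)" using linear_span_image[OF f, of C] C(4) by blast
      also have "f ` C \<subseteq> insert 0 (f ` (C - {x}))" using x(2) by auto
      then have "span (f ` C) \<subseteq> span (f ` (C - {x}))"
        by (metis span_insert_0 span_mono)
      finally have "dim (f ` V) \<le> card (f ` (C - {x}))"
        using finC by (intro dim_le_card) auto
      also have "\<dots> \<le> card (C - {x})" using finC by (intro card_image_le) auto
      also have "\<dots> < card C" using C(1) finC by (intro psubset_card_mono) auto
      finally show False using eq \<open>card C = dim V\<close> by simp
    qed
  qed
qed

lemma finite_dimensional_subset: "finite_dimensional V \<Longrightarrow> S \<subseteq> V \<Longrightarrow> finite_dimensional S"
  unfolding finite_dimensional_def by blast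

theorem theorem3p14:
  fixes p :: "'s \<Rightarrow> 'a::real_normed_vector" and d :: nat
  assumes "finite_dimensional (UNIV :: 'a set)" and "dim (UNIV :: 'a set) = d"
  shows "finite_dimensional (trivial_motions p)
    \<and> d \<le> dim (trivial_motions p)
    \<and> dim (trivial_motions p) \<le> manifold_dim (top_of_set (isometries :: ('a \<Rightarrow> 'a) set))
    \<and> (dim (trivial_motions p) = manifold_dim (top_of_set (isometries :: ('a \<Rightarrow> 'a) set))
        \<longleftrightarrow> full p)"
proof -
  obtain B :: "'a set" where "finite B" "independent B" "span B = UNIV"
    by (rule obtain_finite_basis[OF assms(1)])
  then interpret finite_basis B by unfold_locales
  have lie: "finite_dimensional lie_algebra"
    using finite_dim by (rule finite_dimensional_subset) simp
  have fd: "finite_dimensional (trivial_motions p)"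
    unfolding trivial_motions_eq by (rule finite_dimensional_linear_image[OF lie linear_motion])
  have const: "linear (\<lambda>c (v::'s). c :: 'a)"
    by (rule linearI) (simp_all add: fun_eq_iff scaleR_fun_def)
  have "dim (range (\<lambda>c (v::'s). c :: 'a)) = d"
    using dim_linear_image(2)[OF subspace_UNIV assms(1) const] assms(2) by (simp add: fun_eq_iff)
  moreover have "range (\<lambda>c (v::'s). c :: 'a) \<subseteq> trivial_motions p"
    using constant_is_trivial_motion by blast
  ultimately have "d \<le> dim (trivial_motions p)"
    using dim_mono_finite_dimensional[OF fd] by blast
  moreover note dim_linear_image[OF subspace_lie_algebra lie linear_motion, of p]
  ultimately show ?thesis
    using fd unfolding trivial_motions_eq manifold_dim_isometries full_iff_motion_injective by blast
qed

end
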